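(* Let $R$ be a commutative ring, $M$ a cocommutative bialgebra over $R$, $S$ a commutative $R$-algebra, and $r: M\otimes_R M\to S$ an $S$-valued bicharacter of $M$. Define an operation on $M\otimes_R S$ by $$a\circ_r b := \sum a' b'\, r(a''\otimes b'')\qquad (a,b\in M),$$ extended $S$-bilinearly. (1) $(M\otimes_R S,\circ_r,1_M)$ is a unital associative algebra over $R$, where $1_M$ is the unit of the original algebra structure on $M$. (2) If $r$ is symmetric and $M$ is commutative, then the algebra $(M\otimes_R S,\circ_r,1_M)$ is commutative.
   Context: Sweedler notation: $\Delta_M(a)=\sum a'\otimes a''$ denotes the comultiplication of the bialgebra $M$, and $\varepsilon_M$ its counit. The algebra $M$ is unital and associative but is not assumed commutative unless stated. An element $a \in M$ is viewed in $M\otimes_R S$ as $a\otimes 1$, and $m\, s$ (for $m\in M$, $s\in S$) denotes $m\otimes s$. An $S$-valued bicharacter of $M$ is an $R$-linear map $r:M\otimes_R M\to S$ such that for all $a,b,c\in M$: $$r(a\otimes 1)=\varepsilon_M(a),\quad r(1\otimes a)=\varepsilon_M(a),$$ $$r(ab\otimes c)=\sum r(a\otimes c')\,r(b\otimes c''),\quad r(a\otimes bc)=\sum r(a'\otimes b)\,r(a''\otimes c).$$ It is called symmetric if $r(a\otimes b)=r(b\otimes a)$ for all $a,b\in M$. *)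

theory Defs
  imports "HOL-Algebra.Module" "HOL-Algebra.Generated_Groups" "HOL-Algebra.Free_Abelian_Groups"
begin

section \<open>Algebras and linear maps\<close>

text \<open>The library locale \<open>algebra\<close> is for commutative algebras; this is its noncommutative
  analogue. All algebras over \<open>R\<close> are unital and associative, and the zero ring is allowed.\<close>

locale assoc_algebra = module R A + ring A for R (structure) and A (structure) +
  assumes smult_mult_left: "\<lbrakk>k \<in> carrier R; x \<in> carrier A; y \<in> carrier A\<rbrakk>
      \<Longrightarrow> (k \<odot>\<^bsub>A\<^esub> x) \<otimes>\<^bsub>A\<^esub> y = k \<odot>\<^bsub>A\<^esub> (x \<otimes>\<^bsub>A\<^esub> y)"
    and smult_mult_right: "\<lbrakk>k \<in> carrier R; x \<in> carrier A; y \<in> carrier A\<rbrakk>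
      \<Longrightarrow> x \<otimes>\<^bsub>A\<^esub> (k \<odot>\<^bsub>A\<^esub> y) = k \<odot>\<^bsub>A\<^esub> (x \<otimes>\<^bsub>A\<^esub> y)"

definition linear_maps ::
    "('r, 'x) ring_scheme \<Rightarrow> ('r, 'm, 'y) module_scheme \<Rightarrow> ('r, 'n, 'z) module_scheme \<Rightarrow> ('m \<Rightarrow> 'n) set"
  where "linear_maps R M N =
    {f \<in> hom (add_monoid M) (add_monoid N).
       \<forall>k\<in>carrier R. \<forall>x\<in>carrier M. f (k \<odot>\<^bsub>M\<^esub> x) = k \<odot>\<^bsub>N\<^esub> f x}"

section \<open>Tensor products over a commutative ring\<close>

text \<open>The tensor product of \<open>M\<close> and \<open>N\<close> over \<open>R\<close> is the free abelian group on
  \<open>carrier M \<times> carrier N\<close> modulo the subgroup generated by the bilinearity and balancing relations;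
  its elements are cosets of formal integer combinations of pairs.\<close>

type_synonym ('m, 'n) tensor = "('m \<times> 'n \<Rightarrow>\<^sub>0 int) set"

definition tensor_free ::
    "('r, 'm, 'y) module_scheme \<Rightarrow> ('r, 'n, 'z) module_scheme \<Rightarrow> ('m \<times> 'n \<Rightarrow>\<^sub>0 int) monoid"
  where "tensor_free M N = free_Abelian_group (carrier M \<times> carrier N)"

definition tensor_relators ::
    "('r, 'x) ring_scheme \<Rightarrow> ('r, 'm, 'y) module_scheme \<Rightarrow> ('r, 'n, 'z) module_scheme
      \<Rightarrow> ('m \<times> 'n \<Rightarrow>\<^sub>0 int) set"
  where "tensor_relators R M N =
    {frag_of (x \<oplus>\<^bsub>M\<^esub> x', y) - frag_of (x, y) - frag_of (x', y) | x x' y.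
       x \<in> carrier M \<and> x' \<in> carrier M \<and> y \<in> carrier N}
  \<union> {frag_of (x, y \<oplus>\<^bsub>N\<^esub> y') - frag_of (x, y) - frag_of (x, y') | x y y'.
       x \<in> carrier M \<and> y \<in> carrier N \<and> y' \<in> carrier N}
  \<union> {frag_of (k \<odot>\<^bsub>M\<^esub> x, y) - frag_of (x, k \<odot>\<^bsub>N\<^esub> y) | k x y.
       k \<in> carrier R \<and> x \<in> carrier M \<and> y \<in> carrier N}"

definition tensor_null ::
    "('r, 'x) ring_scheme \<Rightarrow> ('r, 'm, 'y) module_scheme \<Rightarrow> ('r, 'n, 'z) module_scheme
      \<Rightarrow> ('m, 'n) tensor"
  where "tensor_null R M N = generate (tensor_free M N) (tensor_relators R M N)"

definition tensor_class ::
    "('r, 'x) ring_scheme \<Rightarrow> ('r, 'm, 'y) module_scheme \<Rightarrow> ('r, 'n, 'z) module_scheme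
      \<Rightarrow> ('m \<times> 'n \<Rightarrow>\<^sub>0 int) \<Rightarrow> ('m, 'n) tensor"
  where "tensor_class R M N u = tensor_null R M N #>\<^bsub>tensor_free M N\<^esub> u"

definition tensor_rep :: "('m, 'n) tensor \<Rightarrow> ('m \<times> 'n \<Rightarrow>\<^sub>0 int)"
  where "tensor_rep X = (SOME u. u \<in> X)"

definition pure_tensor ::
    "('r, 'x) ring_scheme \<Rightarrow> ('r, 'm, 'y) module_scheme \<Rightarrow> ('r, 'n, 'z) module_scheme
      \<Rightarrow> 'm \<Rightarrow> 'n \<Rightarrow> ('m, 'n) tensor"
  where "pure_tensor R M N x y = tensor_class R M N (frag_of (x, y))"

text \<open>As a module, \<open>k (x \<otimes> y) = (k x) \<otimes> y\<close>. The ring structure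
  \<open>(a \<otimes> b) (c \<otimes> d) = (a c) \<otimes> (b d)\<close> is meaningful only when \<open>M\<close> and \<open>N\<close> are algebras.\<close>

definition tensor ::
    "('r, 'x) ring_scheme \<Rightarrow> ('r, 'm, 'y) module_scheme \<Rightarrow> ('r, 'n, 'z) module_scheme
      \<Rightarrow> ('r, ('m, 'n) tensor) module"
  where "tensor R M N =
    \<lparr>carrier = carrier (tensor_free M N Mod tensor_null R M N),
     monoid.mult = (\<lambda>X Y. tensor_class R M N
       (frag_extend (\<lambda>(a, b). frag_extend (\<lambda>(c, d). frag_of (a \<otimes>\<^bsub>M\<^esub> c, b \<otimes>\<^bsub>N\<^esub> d))
          (tensor_rep Y)) (tensor_rep X))),
     one = pure_tensor R M N \<one>\<^bsub>M\<^esub> \<one>\<^bsub>N\<^esub>,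
     ring.zero = tensor_null R M N,
     ring.add = monoid.mult (tensor_free M N Mod tensor_null R M N),
     smult = (\<lambda>k X. tensor_class R M N
       (frag_extend (\<lambda>(a, b). frag_of (k \<odot>\<^bsub>M\<^esub> a, b)) (tensor_rep X)))\<rparr>"

text \<open>\<open>tensor_lift P f\<close> is the additive map \<open>x \<otimes> y \<mapsto> f x y\<close> induced by a balanced biadditive map
  \<open>f\<close> into \<open>P\<close>; the choice of representative is then irrelevant (lemma \<open>tensor_lift_class\<close> below).
  In Sweedler notation, \<open>tensor_lift P f (\<Delta> a)\<close> is \<open>\<Sum> f a' a''\<close>.\<close>

definition frag_eval :: "('p, 'w) ring_scheme \<Rightarrow> ('m \<Rightarrow> 'n \<Rightarrow> 'p) \<Rightarrow> ('m \<times> 'n \<Rightarrow>\<^sub>0 int) \<Rightarrow> 'p"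
  where "frag_eval P f u =
    (\<Oplus>\<^bsub>P\<^esub>q\<in>Poly_Mapping.keys u. [Poly_Mapping.lookup u q] \<cdot>\<^bsub>P\<^esub> f (fst q) (snd q))"

definition tensor_lift :: "('p, 'w) ring_scheme \<Rightarrow> ('m \<Rightarrow> 'n \<Rightarrow> 'p) \<Rightarrow> ('m, 'n) tensor \<Rightarrow> 'p"
  where "tensor_lift P f X = frag_eval P f (tensor_rep X)"

lemma frag_eval_superset:
  assumes "abelian_group P" and f: "\<And>x y. (x, y) \<in> A \<Longrightarrow> f x y \<in> carrier P"
    and "finite A" "Poly_Mapping.keys u \<subseteq> A"
  shows "frag_eval P f u = (\<Oplus>\<^bsub>P\<^esub>q\<in>A. [Poly_Mapping.lookup u q] \<cdot>\<^bsub>P\<^esub> f (fst q) (snd q))"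
proof -
  interpret P: abelian_group P by fact
  have "[(0::int)] \<cdot>\<^bsub>P\<^esub> z = \<zero>\<^bsub>P\<^esub>" for z
    by (simp add: add_pow_def)
  then show ?thesis
    unfolding frag_eval_def using assms
    by (intro P.add.finprod_mono_neutral_cong_left)
       (auto simp: in_keys_iff intro!: P.add.int_pow_closed)
qed

lemma frag_eval_closed:
  assumes "abelian_group P" and "\<And>x y. (x, y) \<in> Poly_Mapping.keys u \<Longrightarrow> f x y \<in> carrier P"
  shows "frag_eval P f u \<in> carrier P"
proof -
  interpret P: abelian_group P by fact
  show ?thesis
    unfolding frag_eval_def using assms by (auto intro!: P.finsum_closed P.add.int_pow_closed)
qed

lemma frag_eval_of:
  assumes "abelian_group P" and "f x y \<in> carrier P"
  shows "frag_eval P f (frag_of (x, y)) = f x y"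
proof -
  interpret P: abelian_group P by fact
  show ?thesis
    using assms by (simp add: frag_eval_def P.add.int_pow_1)
qed

lemma frag_eval_hom:
  assumes "abelian_group P" and f: "\<And>x y. \<lbrakk>x \<in> carrier M; y \<in> carrier N\<rbrakk> \<Longrightarrow> f x y \<in> carrier P"
  shows "frag_eval P f \<in> hom (tensor_free M N) (add_monoid P)"
proof (rule homI)
  interpret P: abelian_group P by fact
  fix u v assume u: "u \<in> carrier (tensor_free M N)" and v: "v \<in> carrier (tensor_free M N)"
  show "frag_eval P f u \<in> carrier (add_monoid P)"
    using u by (auto simp: tensor_free_def intro!: frag_eval_closed[OF \<open>abelian_group P\<close>] f)
  define A where "A = Poly_Mapping.keys u \<union> Poly_Mapping.keys v"
  have fA: "f x y \<in> carrier P" if "(x, y) \<in> A" for x y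
    using u v that by (auto simp: A_def tensor_free_def intro!: f)
  have A: "finite A" "Poly_Mapping.keys u \<subseteq> A" "Poly_Mapping.keys v \<subseteq> A" "Poly_Mapping.keys (u + v) \<subseteq> A"
    using Poly_Mapping.keys_add[of u v] by (auto simp: A_def)
  have sup: "frag_eval P f w = (\<Oplus>\<^bsub>P\<^esub>q\<in>A. [Poly_Mapping.lookup w q] \<cdot>\<^bsub>P\<^esub> f (fst q) (snd q))"
    if "Poly_Mapping.keys w \<subseteq> A" for w
    using \<open>abelian_group P\<close> fA A(1) that by (rule frag_eval_superset)
  have "frag_eval P f (u + v) = frag_eval P f u \<oplus>\<^bsub>P\<^esub> frag_eval P f v"
  proof -
    have "(\<Oplus>\<^bsub>P\<^esub>q\<in>A. [Poly_Mapping.lookup (u + v) q] \<cdot>\<^bsub>P\<^esub> f (fst q) (snd q)) =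
      (\<Oplus>\<^bsub>P\<^esub>q\<in>A. [Poly_Mapping.lookup u q] \<cdot>\<^bsub>P\<^esub> f (fst q) (snd q)
        \<oplus>\<^bsub>P\<^esub> [Poly_Mapping.lookup v q] \<cdot>\<^bsub>P\<^esub> f (fst q) (snd q))"
      by (rule P.finsum_cong') (auto simp: lookup_add P.add.int_pow_mult fA)
    also have "\<dots> = (\<Oplus>\<^bsub>P\<^esub>q\<in>A. [Poly_Mapping.lookup u q] \<cdot>\<^bsub>P\<^esub> f (fst q) (snd q))
      \<oplus>\<^bsub>P\<^esub> (\<Oplus>\<^bsub>P\<^esub>q\<in>A. [Poly_Mapping.lookup v q] \<cdot>\<^bsub>P\<^esub> f (fst q) (snd q))"
      by (rule P.finsum_addf) (auto simp: fA)
    finally show ?thesis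
      by (simp only: sup[OF A(2)] sup[OF A(3)] sup[OF A(4)])
  qed
  then show "frag_eval P f (u \<otimes>\<^bsub>tensor_free M N\<^esub> v) = frag_eval P f u \<otimes>\<^bsub>add_monoid P\<^esub> frag_eval P f v"
    by (simp add: tensor_free_def)
qed

lemma tensor_lift_class:
  assumes "module R M" "module R N" "abelian_group P"
    and closed: "\<And>x y. \<lbrakk>x \<in> carrier M; y \<in> carrier N\<rbrakk> \<Longrightarrow> f x y \<in> carrier P"
    and add_left: "\<And>x x' y. \<lbrakk>x \<in> carrier M; x' \<in> carrier M; y \<in> carrier N\<rbrakk>
      \<Longrightarrow> f (x \<oplus>\<^bsub>M\<^esub> x') y = f x y \<oplus>\<^bsub>P\<^esub> f x' y"
    and add_right: "\<And>x y y'. \<lbrakk>x \<in> carrier M; y \<in> carrier N; y' \<in> carrier N\<rbrakk>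
      \<Longrightarrow> f x (y \<oplus>\<^bsub>N\<^esub> y') = f x y \<oplus>\<^bsub>P\<^esub> f x y'"
    and balanced: "\<And>k x y. \<lbrakk>k \<in> carrier R; x \<in> carrier M; y \<in> carrier N\<rbrakk>
      \<Longrightarrow> f (k \<odot>\<^bsub>M\<^esub> x) y = f x (k \<odot>\<^bsub>N\<^esub> y)"
    and u: "u \<in> carrier (tensor_free M N)"
  shows "tensor_lift P f (tensor_class R M N u) = frag_eval P f u"
proof -
  interpret M: module R M by fact
  interpret N: module R N by fact
  interpret P: abelian_group P by fact
  let ?F = "tensor_free M N" and ?e = "frag_eval P f"
  interpret F: group ?F by (simp add: tensor_free_def)
  have hom: "?e \<in> hom ?F (add_monoid P)"
    by (rule frag_eval_hom) (use assms in auto)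
  interpret e: group_hom ?F "add_monoid P" ?e
    using hom by unfold_locales
  note ag = \<open>abelian_group P\<close>
  have e_of: "?e (frag_of (x, y)) = f x y" if "x \<in> carrier M" "y \<in> carrier N" for x y
    by (rule frag_eval_of[OF ag]) (use that closed in auto)
  have e_diff: "?e (v - w) = ?e v \<ominus>\<^bsub>P\<^esub> ?e w" if "v \<in> carrier ?F" "w \<in> carrier ?F" for v w
  proof -
    have "?e (v \<otimes>\<^bsub>?F\<^esub> inv\<^bsub>?F\<^esub> w) = ?e v \<oplus>\<^bsub>P\<^esub> (\<ominus>\<^bsub>P\<^esub> ?e w)"
      using that e.hom_mult[of v "inv\<^bsub>?F\<^esub> w"] by (simp add: a_inv_def)
    moreover have "v \<otimes>\<^bsub>?F\<^esub> inv\<^bsub>?F\<^esub> w = v - w"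
      using that by (simp add: tensor_free_def)
    ultimately show ?thesis by (simp add: a_minus_def)
  qed
  have ofF: "frag_of (x, y) \<in> carrier ?F" if "x \<in> carrier M" "y \<in> carrier N" for x y
    using that by (simp add: tensor_free_def)
  have diffF: "v - w \<in> carrier ?F" if "v \<in> carrier ?F" "w \<in> carrier ?F" for v w
    using keys_diff[of v w] that by (auto simp: tensor_free_def)
  have "tensor_relators R M N \<subseteq> kernel ?F (add_monoid P) ?e"
  proof -
    have cancel2: "(a \<oplus>\<^bsub>P\<^esub> b) \<ominus>\<^bsub>P\<^esub> a \<ominus>\<^bsub>P\<^esub> b = \<zero>\<^bsub>P\<^esub>"
      if "a \<in> carrier P" "b \<in> carrier P" for a b
      using that by (simp add: a_minus_def P.a_comm[of a b] P.a_assoc P.r_neg)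
    have cancel1: "a \<ominus>\<^bsub>P\<^esub> a = \<zero>\<^bsub>P\<^esub>" if "a \<in> carrier P" for a
      using that by (simp add: a_minus_def P.r_neg)
    show ?thesis
      unfolding tensor_relators_def kernel_def
      by (auto simp: e_diff e_of ofF diffF closed add_left add_right balanced cancel1 cancel2)
  qed
  then have null: "tensor_null R M N \<subseteq> kernel ?F (add_monoid P) ?e"
    unfolding tensor_null_def by (intro F.generate_subgroup_incl e.subgroup_kernel)
  have "\<zero>\<^bsub>P\<^esub> \<oplus>\<^bsub>P\<^esub> ?e u = ?e u"
    using e.hom_closed[OF u] by simp
  then have all: "?e v = ?e u" if "v \<in> tensor_class R M N u" for v
    using that null u e.hom_mult
    by (auto simp: tensor_class_def r_coset_def kernel_def)
  have "\<one>\<^bsub>?F\<^esub> \<in> tensor_null R M N"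
    unfolding tensor_null_def by (rule generate.one)
  then have "u \<in> tensor_class R M N u"
    using u by (force simp: tensor_class_def r_coset_def)
  then have "tensor_rep (tensor_class R M N u) \<in> tensor_class R M N u"
    unfolding tensor_rep_def by (rule someI)
  then show ?thesis
    by (simp add: tensor_lift_def all)
qed

section \<open>Bialgebras\<close>

text \<open>Coassociativity is \<open>\<Sum> a' \<otimes> ((a'')' \<otimes> (a'')'') = \<Sum> (a')' \<otimes> ((a')'' \<otimes> a'')\<close> in
  \<open>M \<otimes> (M \<otimes> M)\<close>, the right-hand side being the image of \<open>(\<Delta> \<otimes> id) (\<Delta> a)\<close> under the
  associator.\<close>

locale bialgebra = assoc_algebra R M for R (structure) and M (structure) +
  fixes comult :: "'m \<Rightarrow> ('m, 'm) tensor" and counit :: "'m \<Rightarrow> 'r"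
  assumes comult_hom: "comult \<in> ring_hom M (tensor R M M)"
    and comult_linear: "comult \<in> linear_maps R M (tensor R M M)"
    and counit_hom: "counit \<in> ring_hom M R"
    and counit_linear: "\<lbrakk>k \<in> carrier R; a \<in> carrier M\<rbrakk> \<Longrightarrow> counit (k \<odot>\<^bsub>M\<^esub> a) = k \<otimes> counit a"
    and coassoc: "a \<in> carrier M \<Longrightarrow>
      tensor_lift (tensor R M (tensor R M M))
        (\<lambda>a' a''. pure_tensor R M (tensor R M M) a' (comult a'')) (comult a)
    = tensor_lift (tensor R M (tensor R M M))
        (\<lambda>a' a''. tensor_lift (tensor R M (tensor R M M))
          (\<lambda>x y. pure_tensor R M (tensor R M M) x (pure_tensor R M M y a'')) (comult a'))
        (comult a)"
    and counit_left: "a \<in> carrier M \<Longrightarrow>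
      tensor_lift M (\<lambda>a' a''. counit a' \<odot>\<^bsub>M\<^esub> a'') (comult a) = a"
    and counit_right: "a \<in> carrier M \<Longrightarrow>
      tensor_lift M (\<lambda>a' a''. counit a'' \<odot>\<^bsub>M\<^esub> a') (comult a) = a"

locale cocommutative_bialgebra = bialgebra +
  assumes cocommutative: "a \<in> carrier M \<Longrightarrow>
      tensor_lift (tensor R M M) (\<lambda>a' a''. pure_tensor R M M a'' a') (comult a) = comult a"

section \<open>Bicharacters and twisted products\<close>

text \<open>In the first two axioms the scalar \<open>\<epsilon> a\<close> is read in \<open>S\<close> via \<open>k \<mapsto> k 1\<^sub>S\<close>.\<close>

locale bicharacter = bialgebra R M comult counit + S: algebra R S
  for R (structure) and M (structure) and comult counit and S (structure) +
  fixes r :: "('m, 'm) tensor \<Rightarrow> 's"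
  assumes linear: "r \<in> linear_maps R (tensor R M M) S"
    and one_right: "a \<in> carrier M \<Longrightarrow> r (pure_tensor R M M a \<one>\<^bsub>M\<^esub>) = counit a \<odot>\<^bsub>S\<^esub> \<one>\<^bsub>S\<^esub>"
    and one_left: "a \<in> carrier M \<Longrightarrow> r (pure_tensor R M M \<one>\<^bsub>M\<^esub> a) = counit a \<odot>\<^bsub>S\<^esub> \<one>\<^bsub>S\<^esub>"
    and mult_left: "\<lbrakk>a \<in> carrier M; b \<in> carrier M; c \<in> carrier M\<rbrakk> \<Longrightarrow>
      r (pure_tensor R M M (a \<otimes>\<^bsub>M\<^esub> b) c) =
      tensor_lift S (\<lambda>c' c''. r (pure_tensor R M M a c') \<otimes>\<^bsub>S\<^esub> r (pure_tensor R M M b c'')) (comult c)"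
    and mult_right: "\<lbrakk>a \<in> carrier M; b \<in> carrier M; c \<in> carrier M\<rbrakk> \<Longrightarrow>
      r (pure_tensor R M M a (b \<otimes>\<^bsub>M\<^esub> c)) =
      tensor_lift S (\<lambda>a' a''. r (pure_tensor R M M a' b) \<otimes>\<^bsub>S\<^esub> r (pure_tensor R M M a'' c)) (comult a)"

definition symmetric_bicharacter ::
    "('r, 'x) ring_scheme \<Rightarrow> ('r, 'm, 'y) module_scheme \<Rightarrow> (('m, 'm) tensor \<Rightarrow> 's) \<Rightarrow> bool"
  where "symmetric_bicharacter R M r \<longleftrightarrow>
    (\<forall>a\<in>carrier M. \<forall>b\<in>carrier M. r (pure_tensor R M M a b) = r (pure_tensor R M M b a))"

text \<open>\<open>scalar_ext_smult\<close> is the \<open>S\<close>-module structure \<open>s (m \<otimes> t) = m \<otimes> (s t)\<close> of \<open>M \<otimes> S\<close>.\<close>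

definition scalar_ext_smult ::
    "('r, 'x) ring_scheme \<Rightarrow> ('r, 'm, 'y) module_scheme \<Rightarrow> ('r, 's, 'z) module_scheme
      \<Rightarrow> 's \<Rightarrow> ('m, 's) tensor \<Rightarrow> ('m, 's) tensor"
  where "scalar_ext_smult R M S s X =
    tensor_lift (tensor R M S) (\<lambda>m t. pure_tensor R M S m (s \<otimes>\<^bsub>S\<^esub> t)) X"

text \<open>For \<open>a, b\<close> in \<open>M\<close>: \<open>\<Sum> a' b' \<otimes> r (a'' \<otimes> b'')\<close>.\<close>

definition twisted_prod ::
    "('r, 'x) ring_scheme \<Rightarrow> ('r, 'm, 'y) module_scheme \<Rightarrow> ('m \<Rightarrow> ('m, 'm) tensor)
      \<Rightarrow> ('r, 's, 'z) module_scheme \<Rightarrow> (('m, 'm) tensor \<Rightarrow> 's) \<Rightarrow> 'm \<Rightarrow> 'm \<Rightarrow> ('m, 's) tensor"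
  where "twisted_prod R M comult S r a b =
    tensor_lift (tensor R M S) (\<lambda>a' a''.
      tensor_lift (tensor R M S) (\<lambda>b' b''.
        pure_tensor R M S (a' \<otimes>\<^bsub>M\<^esub> b') (r (pure_tensor R M M a'' b'')))
      (comult b)) (comult a)"

text \<open>The \<open>S\<close>-bilinear extension: \<open>(a \<otimes> s) \<circ> (b \<otimes> t) = (s t) (a \<circ> b)\<close>.\<close>

definition twisted_mult ::
    "('r, 'x) ring_scheme \<Rightarrow> ('r, 'm, 'y) module_scheme \<Rightarrow> ('m \<Rightarrow> ('m, 'm) tensor)
      \<Rightarrow> ('r, 's, 'z) module_scheme \<Rightarrow> (('m, 'm) tensor \<Rightarrow> 's)
      \<Rightarrow> ('m, 's) tensor \<Rightarrow> ('m, 's) tensor \<Rightarrow> ('m, 's) tensor"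
  where "twisted_mult R M comult S r X Y =
    tensor_lift (tensor R M S) (\<lambda>a s.
      tensor_lift (tensor R M S) (\<lambda>b t.
        scalar_ext_smult R M S (s \<otimes>\<^bsub>S\<^esub> t) (twisted_prod R M comult S r a b)) Y) X"

definition twisted_algebra ::
    "('r, 'x) ring_scheme \<Rightarrow> ('r, 'm, 'y) module_scheme \<Rightarrow> ('m \<Rightarrow> ('m, 'm) tensor)
      \<Rightarrow> ('r, 's, 'z) module_scheme \<Rightarrow> (('m, 'm) tensor \<Rightarrow> 's) \<Rightarrow> ('r, ('m, 's) tensor) module"
  where "twisted_algebra R M comult S r =
    (tensor R M S)\<lparr>monoid.mult := twisted_mult R M comult S r,
                   one := pure_tensor R M S \<one>\<^bsub>M\<^esub> \<one>\<^bsub>S\<^esub>\<rparr>"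

end

theory Submission
  imports Defs
begin

text \<open>
  Written in Sweedler notation, the theorem is a computation with finite sums. Put
  \<open>\<rho>(x, y) = r (x \<otimes> y)\<close>, and write \<open>a(1)\<close>, \<open>a(2)\<close>, \<open>a(3)\<close> for the legs of the twofold
  coproduct of \<open>a\<close>. Since \<open>\<Delta>\<close> is multiplicative and \<open>r\<close> is a bicharacter, coassociativity gives

  \<open>(a \<circ> b) \<circ> c = \<Sum> a(1) b(1) c(1) \<rho>(a(2), c(2)) \<rho>(b(2), c(3)) \<rho>(a(3), b(3))\<close>,

  \<open>a \<circ> (b \<circ> c) = \<Sum> a(1) b(1) c(1) \<rho>(a(2), b(2)) \<rho>(a(3), c(2)) \<rho>(b(3), c(3))\<close>.

  The two sums differ by exchanging the last two legs of \<open>a\<close> and the last two legs of \<open>b\<close>, which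
  cocommutativity permits (\<open>twisted_pure_assoc_left\<close>, \<open>twisted_pure_assoc_right\<close>,
  \<open>twisted_pure_assoc\<close>). The unit laws follow from \<open>\<Delta> 1 = 1 \<otimes> 1\<close>, from
  \<open>\<rho>(1, b) = \<epsilon>(b) = \<rho>(b, 1)\<close> and from the counit axiom. If \<open>M\<close> is commutative and \<open>r\<close> is symmetric,
  then every summand of \<open>a \<circ> b\<close> is a summand of \<open>b \<circ> a\<close>.

  To make such computations formal, a Sweedler sum \<open>\<Sum> f(a', a'')\<close> is read as the map induced by
  \<open>f\<close> on the tensor product, applied to \<open>\<Delta> a\<close>. Everything then reduces to a few properties of induced
  maps: they are linear, they are determined by their values on pure tensors, linear maps can be
  applied under them, two of them can be interchanged, and on a product of tensors they become a
  nested sum. The remaining obligations say that some expression is linear in one of its variables;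
  as each variable occurs exactly once, these are settled by syntax-directed rules.
\<close>

section \<open>Linear and bilinear maps\<close>

lemma linear_mapsI:
  assumes "\<And>x. x \<in> carrier M \<Longrightarrow> f x \<in> carrier N"
    and "\<And>x y. \<lbrakk>x \<in> carrier M; y \<in> carrier M\<rbrakk> \<Longrightarrow> f (x \<oplus>\<^bsub>M\<^esub> y) = f x \<oplus>\<^bsub>N\<^esub> f y"
    and "\<And>k x. \<lbrakk>k \<in> carrier R; x \<in> carrier M\<rbrakk> \<Longrightarrow> f (k \<odot>\<^bsub>M\<^esub> x) = k \<odot>\<^bsub>N\<^esub> f x"
  shows "f \<in> linear_maps R M N"
  using assms by (auto simp: linear_maps_def intro!: homI)

lemma linear_maps_hom: "f \<in> linear_maps R M N \<Longrightarrow> f \<in> hom (add_monoid M) (add_monoid N)"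
  by (simp add: linear_maps_def)

lemma linear_maps_closed: "\<lbrakk>f \<in> linear_maps R M N; x \<in> carrier M\<rbrakk> \<Longrightarrow> f x \<in> carrier N"
  by (auto simp: linear_maps_def hom_def)

lemma linear_maps_add:
  "\<lbrakk>f \<in> linear_maps R M N; x \<in> carrier M; y \<in> carrier M\<rbrakk> \<Longrightarrow> f (x \<oplus>\<^bsub>M\<^esub> y) = f x \<oplus>\<^bsub>N\<^esub> f y"
  by (auto simp: linear_maps_def hom_def)

lemma linear_maps_smult:
  "\<lbrakk>f \<in> linear_maps R M N; k \<in> carrier R; x \<in> carrier M\<rbrakk> \<Longrightarrow> f (k \<odot>\<^bsub>M\<^esub> x) = k \<odot>\<^bsub>N\<^esub> f x"
  by (auto simp: linear_maps_def)

lemma linear_maps_id: "(\<lambda>x. x) \<in> linear_maps R M M"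
  by (rule linear_mapsI) simp_all

lemma linear_maps_comp:
  assumes "g \<in> linear_maps R N P" "f \<in> linear_maps R M N"
  shows "(\<lambda>x. g (f x)) \<in> linear_maps R M P"
  using assms
  by (intro linear_mapsI)
     (simp_all add: linear_maps_closed[OF assms(1)] linear_maps_closed[OF assms(2)]
       linear_maps_add[OF assms(1)] linear_maps_add[OF assms(2)]
       linear_maps_smult[OF assms(1)] linear_maps_smult[OF assms(2)])

definition bilinear_maps ::
    "('r, 'x) ring_scheme \<Rightarrow> ('r, 'm, 'y) module_scheme \<Rightarrow> ('r, 'n, 'z) module_scheme
      \<Rightarrow> ('r, 'p, 'w) module_scheme \<Rightarrow> ('m \<Rightarrow> 'n \<Rightarrow> 'p) set"
  where "bilinear_maps R M N P =
    {f. (\<forall>x\<in>carrier M. (\<lambda>y. f x y) \<in> linear_maps R N P)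
      \<and> (\<forall>y\<in>carrier N. (\<lambda>x. f x y) \<in> linear_maps R M P)}"

lemma bilinear_mapsI:
  assumes "\<And>y. y \<in> carrier N \<Longrightarrow> (\<lambda>x. f x y) \<in> linear_maps R M P"
    and "\<And>x. x \<in> carrier M \<Longrightarrow> (\<lambda>y. f x y) \<in> linear_maps R N P"
  shows "f \<in> bilinear_maps R M N P"
  using assms by (simp add: bilinear_maps_def)

lemma bilinear_maps_left:
  "\<lbrakk>f \<in> bilinear_maps R M N P; y \<in> carrier N\<rbrakk> \<Longrightarrow> (\<lambda>x. f x y) \<in> linear_maps R M P"
  by (simp add: bilinear_maps_def)

lemma bilinear_maps_right:
  "\<lbrakk>f \<in> bilinear_maps R M N P; x \<in> carrier M\<rbrakk> \<Longrightarrow> f x \<in> linear_maps R N P"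
  by (simp add: bilinear_maps_def)

lemma bilinear_maps_closed:
  "\<lbrakk>f \<in> bilinear_maps R M N P; x \<in> carrier M; y \<in> carrier N\<rbrakk> \<Longrightarrow> f x y \<in> carrier P"
  by (meson bilinear_maps_right linear_maps_closed)

section \<open>Evaluating formal combinations of pairs\<close>

text \<open>Most identities between evaluations of formal combinations follow from this principle: both sides
  are additive in the combination, so that it is enough to compare them on a single pair.\<close>

lemma hom_tensor_free_eqI:
  assumes "group G" and \<phi>: "\<phi> \<in> hom (tensor_free M N) G" and \<psi>: "\<psi> \<in> hom (tensor_free M N) G"
    and eq: "\<And>x y. \<lbrakk>x \<in> carrier M; y \<in> carrier N\<rbrakk> \<Longrightarrow> \<phi> (frag_of (x, y)) = \<psi> (frag_of (x, y))"
    and u: "u \<in> carrier (tensor_free M N)"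
  shows "\<phi> u = \<psi> u"
proof -
  let ?F = "tensor_free M N"
  interpret F: group ?F by (simp add: tensor_free_def)
  interpret \<phi>: group_hom ?F G \<phi>
    using assms(1) \<phi> by (intro group_hom.intro F.is_group) (simp_all add: group_hom_axioms_def)
  interpret \<psi>: group_hom ?F G \<psi>
    using assms(1) \<psi> by (intro group_hom.intro F.is_group) (simp_all add: group_hom_axioms_def)
  have "Poly_Mapping.keys u \<subseteq> carrier M \<times> carrier N"
    using u by (simp add: tensor_free_def)
  then show ?thesis
  proof (induction u rule: free_Abelian_group_induct[consumes 1, case_names zero diff gen])
    case zero
    then show ?case
      using \<phi>.hom_one \<psi>.hom_one by (simp add: tensor_free_def)
  next
    case (diff v w)
    then have vw: "v \<in> carrier ?F" "w \<in> carrier ?F"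
      by (simp_all add: tensor_free_def)
    have "v - w = v \<otimes>\<^bsub>?F\<^esub> inv\<^bsub>?F\<^esub> w"
      using diff by (simp add: tensor_free_def)
    then show ?case
      using vw diff by simp
  next
    case (gen a)
    then show ?case
      using eq by (cases a) auto
  qed
qed

context
  fixes M :: "('r, 'm, 'y) module_scheme" and N :: "('r, 'n, 'z) module_scheme"
    and P :: "('p, 'w) ring_scheme"
  assumes P: "abelian_group P"
begin

interpretation P: abelian_group P by (fact P)

lemma frag_eval_in_carrier:
  assumes "\<And>x y. \<lbrakk>x \<in> carrier M; y \<in> carrier N\<rbrakk> \<Longrightarrow> f x y \<in> carrier P"
    and "u \<in> carrier (tensor_free M N)"
  shows "frag_eval P f u \<in> carrier P"
  using frag_eval_hom[OF P, of M N f] assms by (auto simp: hom_def)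

lemma frag_eval_cong:
  assumes "\<And>x y. \<lbrakk>x \<in> carrier M; y \<in> carrier N\<rbrakk> \<Longrightarrow> f x y = g x y"
    and g: "\<And>x y. \<lbrakk>x \<in> carrier M; y \<in> carrier N\<rbrakk> \<Longrightarrow> g x y \<in> carrier P"
    and u: "u \<in> carrier (tensor_free M N)"
  shows "frag_eval P f u = frag_eval P g u"
  by (rule hom_tensor_free_eqI[OF P.a_group, OF frag_eval_hom[OF P] frag_eval_hom[OF P] _ u])
     (simp_all add: assms frag_eval_of[OF P])

lemma frag_eval_image:
  assumes Q: "abelian_group Q" and g: "g \<in> hom (add_monoid P) (add_monoid Q)"
    and f: "\<And>x y. \<lbrakk>x \<in> carrier M; y \<in> carrier N\<rbrakk> \<Longrightarrow> f x y \<in> carrier P"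
    and u: "u \<in> carrier (tensor_free M N)"
  shows "g (frag_eval P f u) = frag_eval Q (\<lambda>x y. g (f x y)) u"
proof -
  interpret Q: abelian_group Q by fact
  have gc: "g z \<in> carrier Q" if "z \<in> carrier P" for z
    using g that by (auto simp: hom_def)
  have "(\<lambda>u. g (frag_eval P f u)) \<in> hom (tensor_free M N) (add_monoid Q)"
    using hom_compose[OF frag_eval_hom[OF P, of M N f] g] f by (simp add: comp_def)
  then show ?thesis
    by (rule hom_tensor_free_eqI[OF Q.a_group _ frag_eval_hom[OF Q] _ u])
       (simp_all add: f gc frag_eval_of[OF P] frag_eval_of[OF Q])
qed

lemma frag_eval_pointwise_add:
  assumes f: "\<And>x y. \<lbrakk>x \<in> carrier M; y \<in> carrier N\<rbrakk> \<Longrightarrow> f x y \<in> carrier P"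
    and g: "\<And>x y. \<lbrakk>x \<in> carrier M; y \<in> carrier N\<rbrakk> \<Longrightarrow> g x y \<in> carrier P"
    and u: "u \<in> carrier (tensor_free M N)"
  shows "frag_eval P (\<lambda>x y. f x y \<oplus>\<^bsub>P\<^esub> g x y) u = frag_eval P f u \<oplus>\<^bsub>P\<^esub> frag_eval P g u"
proof -
  have hf: "frag_eval P f \<in> hom (tensor_free M N) (add_monoid P)"
    and hg: "frag_eval P g \<in> hom (tensor_free M N) (add_monoid P)"
    using frag_eval_hom[OF P] f g by metis+
  have "(\<lambda>u. frag_eval P f u \<oplus>\<^bsub>P\<^esub> frag_eval P g u) \<in> hom (tensor_free M N) (add_monoid P)"
    using hf hg hom_in_carrier[OF hf] hom_in_carrier[OF hg]
    by (intro homI) (simp_all add: hom_mult P.a_ac)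
  then show ?thesis
    by (intro hom_tensor_free_eqI[OF P.a_group frag_eval_hom[OF P] _ _ u])
       (simp_all add: f g frag_eval_of[OF P])
qed

text \<open>Substituting combinations into a combination and then evaluating is a nested evaluation. The
  multiplication and the scalar multiplication of tensors are defined by substitution into a chosen
  representative, and this lemma turns them into iterated sums.\<close>

lemma frag_eval_frag_extend:
  fixes M' :: "('r, 'm2, 'y2) module_scheme" and N' :: "('r, 'n2, 'z2) module_scheme"
  assumes f: "\<And>x y. \<lbrakk>x \<in> carrier M'; y \<in> carrier N'\<rbrakk> \<Longrightarrow> f x y \<in> carrier P"
    and h: "\<And>x y. \<lbrakk>x \<in> carrier M; y \<in> carrier N\<rbrakk> \<Longrightarrow> h x y \<in> carrier (tensor_free M' N')"
    and u: "u \<in> carrier (tensor_free M N)"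
  shows "frag_extend (\<lambda>(x, y). h x y) u \<in> carrier (tensor_free M' N')" (is ?A)
    and "frag_eval P f (frag_extend (\<lambda>(x, y). h x y) u) =
      frag_eval P (\<lambda>x y. frag_eval P f (h x y)) u" (is ?B)
proof -
  have ext: "frag_extend (\<lambda>(x, y). h x y) u \<in> carrier (tensor_free M' N')"
    if "u \<in> carrier (tensor_free M N)" for u
    using keys_frag_extend[of "\<lambda>(x, y). h x y" u] that h
    by (fastforce simp: tensor_free_def split: prod.splits)
  from ext[OF u] show ?A .
  have hom: "frag_extend (\<lambda>(x, y). h x y) \<in> hom (tensor_free M N) (tensor_free M' N')"
    by (rule homI) (use ext in \<open>simp_all add: tensor_free_def frag_extend_add\<close>)
  have "(\<lambda>u. frag_eval P f (frag_extend (\<lambda>(x, y). h x y) u)) \<in> hom (tensor_free M N) (add_monoid P)"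
    using hom_compose[OF hom frag_eval_hom[OF P, of M' N' f]] f by (simp add: comp_def)
  then show ?B
    by (rule hom_tensor_free_eqI[OF P.a_group _ frag_eval_hom[OF P] _ u])
       (use f h frag_eval_hom[OF P, of M' N' f] in
         \<open>simp_all add: frag_eval_of[OF P] hom_def Pi_iff\<close>)
qed

end

text \<open>Fubini for formal combinations. As it concerns combinations themselves rather than their classes,
  it holds for every family of values \<open>f\<close> in the group.\<close>

lemma frag_eval_swap:
  assumes P: "abelian_group P"
    and f: "\<And>x y a b. \<lbrakk>x \<in> carrier M; y \<in> carrier N; a \<in> carrier M'; b \<in> carrier N'\<rbrakk>
      \<Longrightarrow> f x y a b \<in> carrier P"
    and u: "u \<in> carrier (tensor_free M N)" and v: "v \<in> carrier (tensor_free M' N')"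
  shows "frag_eval P (\<lambda>x y. frag_eval P (f x y) v) u =
    frag_eval P (\<lambda>a b. frag_eval P (\<lambda>x y. f x y a b) u) v"
proof -
  interpret P: abelian_group P by fact
  have inner: "frag_eval P (\<lambda>x y. f x y a b) \<in> hom (tensor_free M N) (add_monoid P)"
    if "a \<in> carrier M'" "b \<in> carrier N'" for a b
    using that f by (intro frag_eval_hom[OF P]) auto
  then have "frag_eval P (\<lambda>a b. frag_eval P (\<lambda>x y. f x y a b) (p \<otimes>\<^bsub>tensor_free M N\<^esub> q)) v
      = frag_eval P (\<lambda>a b. frag_eval P (\<lambda>x y. f x y a b) p \<oplus>\<^bsub>P\<^esub> frag_eval P (\<lambda>x y. f x y a b) q) v"
    if "p \<in> carrier (tensor_free M N)" "q \<in> carrier (tensor_free M N)" for p q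
    using that by (intro frag_eval_cong[OF P _ _ v]) (auto simp: hom_def)
  moreover have cl: "frag_eval P (\<lambda>x y. f x y a b) p \<in> carrier P"
    if "p \<in> carrier (tensor_free M N)" "a \<in> carrier M'" "b \<in> carrier N'" for p a b
    using that inner[of a b] by (auto simp: hom_def)
  ultimately have "(\<lambda>u. frag_eval P (\<lambda>a b. frag_eval P (\<lambda>x y. f x y a b) u) v)
      \<in> hom (tensor_free M N) (add_monoid P)"
    using v by (intro homI)
      (simp_all add: frag_eval_in_carrier[OF P, where M = M' and N = N'] frag_eval_pointwise_add[OF P, where M = M' and N = N'])
  moreover have cl': "frag_eval P (f x y) v \<in> carrier P" if "x \<in> carrier M" "y \<in> carrier N" for x y
    using v f that by (intro frag_eval_in_carrier[OF P, where M = M' and N = N']) auto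
  moreover have "frag_eval P (f x y) v = frag_eval P (\<lambda>a b. frag_eval P (\<lambda>x y. f x y a b) (frag_of (x, y))) v"
    if "x \<in> carrier M" "y \<in> carrier N" for x y
    using v f that by (intro frag_eval_cong[OF P, where M = M' and N = N']) (auto simp: frag_eval_of[OF P])
  ultimately show ?thesis
    by (intro hom_tensor_free_eqI[OF P.a_group frag_eval_hom[OF P] _ _ u]) (simp_all add: frag_eval_of[OF P])
qed

section \<open>The tensor product as a module\<close>

context
  fixes R :: "('r, 'x) ring_scheme"
    and M :: "('r, 'm, 'y) module_scheme" and N :: "('r, 'n, 'z) module_scheme"
  assumes M: "module R M" and N: "module R N"
begin

interpretation M: module R M by (fact M)
interpretation N: module R N by (fact N)

private abbreviation (input) "T \<equiv> tensor R M N"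
private abbreviation (input) "F \<equiv> tensor_free M N"
private abbreviation (input) "K \<equiv> tensor_null R M N"
private abbreviation (input) "pure \<equiv> pure_tensor R M N"

interpretation F: comm_group F
  by (simp add: tensor_free_def abelian_free_Abelian_group)

lemma tensor_relators_subset: "tensor_relators R M N \<subseteq> carrier F"
proof -
  have "frag_of p - q \<in> carrier F" if "frag_of p \<in> carrier F" "q \<in> carrier F" for p q
    using keys_diff[of "frag_of p" q] that by (auto simp: tensor_free_def)
  moreover have "p - q \<in> carrier F" if "p \<in> carrier F" "q \<in> carrier F" for p q
    using keys_diff[of p q] that by (auto simp: tensor_free_def)
  moreover have "frag_of (x, y) \<in> carrier F" if "x \<in> carrier M" "y \<in> carrier N" for x y
    using that by (simp add: tensor_free_def)
  ultimately show ?thesis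
    unfolding tensor_relators_def by auto
qed

lemma tensor_null_normal: "K \<lhd> F"
  unfolding tensor_null_def
  using F.generate_is_subgroup[OF tensor_relators_subset] by (simp add: F.normal_iff_subgroup)

interpretation K: normal K F by (fact tensor_null_normal)

lemma tensor_additive:
  shows carrier_tensor: "carrier T = carrier (F Mod K)"
    and add_tensor: "add T = monoid.mult (F Mod K)"
    and zero_tensor: "\<zero>\<^bsub>T\<^esub> = \<one>\<^bsub>F Mod K\<^esub>"
  by (simp_all add: tensor_def FactGroup_def)

lemma tensor_abelian_group: "abelian_group T"
proof -
  interpret Q: comm_group "F Mod K"
    by (rule F.abelian_FactGroup[OF K.subgroup_axioms])
  show ?thesis
    by (rule abelian_groupI; unfold tensor_additive)
       ((rule Q.m_closed Q.one_closed Q.m_assoc Q.m_comm Q.l_one Q.l_inv_ex; assumption)+)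
qed

interpretation T: abelian_group T by (fact tensor_abelian_group)

lemma tensor_class_hom: "tensor_class R M N \<in> hom F (add_monoid T)"
  using K.r_coset_hom_Mod by (simp add: hom_def tensor_additive tensor_class_def[abs_def])

lemma tensor_rep:
  assumes "X \<in> carrier T"
  shows tensor_rep_in_free: "tensor_rep X \<in> carrier F"
    and tensor_class_rep: "tensor_class R M N (tensor_rep X) = X"
proof -
  obtain u where u: "u \<in> carrier F" and X: "X = K #>\<^bsub>F\<^esub> u"
    using assms by (auto simp: tensor_def FactGroup_def RCOSETS_def)
  then have "u \<in> X"
    using F.rcos_self[OF u K.subgroup_axioms] by simp
  then have rep: "tensor_rep X \<in> K #>\<^bsub>F\<^esub> u"
    unfolding tensor_rep_def X by (rule someI)
  then show "tensor_rep X \<in> carrier F"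
    using F.r_coset_subset_G[OF K.subset u] by auto
  show "tensor_class R M N (tensor_rep X) = X"
    using F.repr_independence[OF rep u K.subgroup_axioms] X by (simp add: tensor_class_def)
qed

lemma frag_of_in_tensor_free: "\<lbrakk>x \<in> carrier M; y \<in> carrier N\<rbrakk> \<Longrightarrow> frag_of (x, y) \<in> carrier F"
  by (simp add: tensor_free_def)

lemma pure_tensor_closed: "\<lbrakk>x \<in> carrier M; y \<in> carrier N\<rbrakk> \<Longrightarrow> pure x y \<in> carrier T"
  using hom_in_carrier[OF tensor_class_hom frag_of_in_tensor_free] by (simp add: pure_tensor_def)

text \<open>Each defining relation becomes an equation between classes because its two sides differ by a
  relator; the bilinearity of \<open>\<otimes>\<close> is read off from this in the next lemmas.\<close>

lemma tensor_class_relator: "d \<in> tensor_relators R M N \<Longrightarrow> tensor_class R M N d = \<zero>\<^bsub>T\<^esub>"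
  unfolding tensor_class_def
  using F.coset_join2[OF _ K.subgroup_axioms, of d] tensor_relators_subset generate.incl[of d _ F]
  by (auto simp: tensor_def tensor_null_def)

lemma tensor_free_add: "\<lbrakk>u \<in> carrier F; v \<in> carrier F\<rbrakk> \<Longrightarrow> u + v \<in> carrier F"
  using F.m_closed[of u v] unfolding tensor_free_def by simp

lemma tensor_class_add:
  "\<lbrakk>u \<in> carrier F; v \<in> carrier F\<rbrakk>
    \<Longrightarrow> tensor_class R M N (u + v) = tensor_class R M N u \<oplus>\<^bsub>T\<^esub> tensor_class R M N v"
  using hom_mult[OF tensor_class_hom] by (simp add: tensor_free_def)

lemma pure_tensor_add_left:
  assumes "x \<in> carrier M" "x' \<in> carrier M" "y \<in> carrier N"
  shows "pure (x \<oplus>\<^bsub>M\<^esub> x') y = pure x y \<oplus>\<^bsub>T\<^esub> pure x' y"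
proof -
  let ?d = "frag_of (x \<oplus>\<^bsub>M\<^esub> x', y) - frag_of (x, y) - frag_of (x', y)"
  have d: "?d \<in> tensor_relators R M N"
    using assms unfolding tensor_relators_def by blast
  have "pure (x \<oplus>\<^bsub>M\<^esub> x') y = tensor_class R M N (?d + (frag_of (x, y) + frag_of (x', y)))"
    by (simp add: pure_tensor_def)
  also have "\<dots> = tensor_class R M N ?d \<oplus>\<^bsub>T\<^esub> tensor_class R M N (frag_of (x, y) + frag_of (x', y))"
    using d tensor_relators_subset assms
    by (intro tensor_class_add tensor_free_add frag_of_in_tensor_free) auto
  also have "\<dots> = pure x y \<oplus>\<^bsub>T\<^esub> pure x' y"
    using assms by (simp add: tensor_class_relator[OF d] tensor_class_add frag_of_in_tensor_free
        pure_tensor_closed flip: pure_tensor_def)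
  finally show ?thesis .
qed

lemma pure_tensor_add_right:
  assumes "x \<in> carrier M" "y \<in> carrier N" "y' \<in> carrier N"
  shows "pure x (y \<oplus>\<^bsub>N\<^esub> y') = pure x y \<oplus>\<^bsub>T\<^esub> pure x y'"
proof -
  let ?d = "frag_of (x, y \<oplus>\<^bsub>N\<^esub> y') - frag_of (x, y) - frag_of (x, y')"
  have d: "?d \<in> tensor_relators R M N"
    using assms unfolding tensor_relators_def by blast
  have "pure x (y \<oplus>\<^bsub>N\<^esub> y') = tensor_class R M N (?d + (frag_of (x, y) + frag_of (x, y')))"
    by (simp add: pure_tensor_def)
  also have "\<dots> = tensor_class R M N ?d \<oplus>\<^bsub>T\<^esub> tensor_class R M N (frag_of (x, y) + frag_of (x, y'))"
    using d tensor_relators_subset assms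
    by (intro tensor_class_add tensor_free_add frag_of_in_tensor_free) auto
  also have "\<dots> = pure x y \<oplus>\<^bsub>T\<^esub> pure x y'"
    using assms by (simp add: tensor_class_relator[OF d] tensor_class_add frag_of_in_tensor_free
        pure_tensor_closed flip: pure_tensor_def)
  finally show ?thesis .
qed

lemma pure_tensor_balanced:
  assumes "k \<in> carrier R" "x \<in> carrier M" "y \<in> carrier N"
  shows "pure (k \<odot>\<^bsub>M\<^esub> x) y = pure x (k \<odot>\<^bsub>N\<^esub> y)"
proof -
  let ?d = "frag_of (k \<odot>\<^bsub>M\<^esub> x, y) - frag_of (x, k \<odot>\<^bsub>N\<^esub> y)"
  have d: "?d \<in> tensor_relators R M N"
    using assms unfolding tensor_relators_def by blast
  have "pure (k \<odot>\<^bsub>M\<^esub> x) y = tensor_class R M N (?d + frag_of (x, k \<odot>\<^bsub>N\<^esub> y))"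
    by (simp add: pure_tensor_def)
  also have "\<dots> = tensor_class R M N ?d \<oplus>\<^bsub>T\<^esub> pure x (k \<odot>\<^bsub>N\<^esub> y)"
    unfolding pure_tensor_def using d tensor_relators_subset assms
    by (intro tensor_class_add frag_of_in_tensor_free) auto
  also have "\<dots> = pure x (k \<odot>\<^bsub>N\<^esub> y)"
    using assms by (simp add: tensor_class_relator[OF d] pure_tensor_closed)
  finally show ?thesis .
qed

text \<open>The class of a combination is the corresponding sum of pure tensors, so that evaluation in the
  tensor product itself describes every element.\<close>

lemma tensor_class_eq_frag_eval:
  "u \<in> carrier F \<Longrightarrow> tensor_class R M N u = frag_eval T pure u"
  by (rule hom_tensor_free_eqI[OF T.a_group tensor_class_hom frag_eval_hom[OF tensor_abelian_group]])
     (simp_all add: pure_tensor_closed frag_eval_of[OF tensor_abelian_group], simp add: pure_tensor_def)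

text \<open>Pure tensors generate the tensor product.\<close>

lemma hom_tensor_eqI:
  assumes "group G" and \<phi>: "\<phi> \<in> hom (add_monoid T) G" and \<psi>: "\<psi> \<in> hom (add_monoid T) G"
    and eq: "\<And>x y. \<lbrakk>x \<in> carrier M; y \<in> carrier N\<rbrakk> \<Longrightarrow> \<phi> (pure x y) = \<psi> (pure x y)"
    and X: "X \<in> carrier T"
  shows "\<phi> X = \<psi> X"
proof -
  have "(\<phi> \<circ> tensor_class R M N) (tensor_rep X) = (\<psi> \<circ> tensor_class R M N) (tensor_rep X)"
    by (rule hom_tensor_free_eqI[OF \<open>group G\<close> hom_compose hom_compose _ tensor_rep_in_free[OF X]])
       (use \<phi> \<psi> tensor_class_hom eq in \<open>simp_all add: pure_tensor_def\<close>)
  then show ?thesis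
    by (simp add: tensor_class_rep[OF X])
qed

text \<open>Here \<open>f\<close> is biadditive and balanced, with values in a group that need not carry a scalar
  multiplication. This generality is needed to construct the scalar multiplication of the tensor
  product before that tensor product is known to be a module.\<close>

lemma
  assumes P: "abelian_group P"
    and closed: "\<And>x y. \<lbrakk>x \<in> carrier M; y \<in> carrier N\<rbrakk> \<Longrightarrow> f x y \<in> carrier P"
    and add_left: "\<And>x x' y. \<lbrakk>x \<in> carrier M; x' \<in> carrier M; y \<in> carrier N\<rbrakk>
      \<Longrightarrow> f (x \<oplus>\<^bsub>M\<^esub> x') y = f x y \<oplus>\<^bsub>P\<^esub> f x' y"
    and add_right: "\<And>x y y'. \<lbrakk>x \<in> carrier M; y \<in> carrier N; y' \<in> carrier N\<rbrakk>
      \<Longrightarrow> f x (y \<oplus>\<^bsub>N\<^esub> y') = f x y \<oplus>\<^bsub>P\<^esub> f x y'"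
    and balanced: "\<And>k x y. \<lbrakk>k \<in> carrier R; x \<in> carrier M; y \<in> carrier N\<rbrakk>
      \<Longrightarrow> f (k \<odot>\<^bsub>M\<^esub> x) y = f x (k \<odot>\<^bsub>N\<^esub> y)"
  shows tensor_lift_hom: "tensor_lift P f \<in> hom (add_monoid T) (add_monoid P)"
    and tensor_lift_balanced_pure:
      "\<lbrakk>x \<in> carrier M; y \<in> carrier N\<rbrakk> \<Longrightarrow> tensor_lift P f (pure x y) = f x y"
proof -
  have lift: "tensor_lift P f (tensor_class R M N u) = frag_eval P f u" if "u \<in> carrier F" for u
    using M N P closed add_left add_right balanced that by (rule tensor_lift_class)
  have hom: "frag_eval P f \<in> hom F (add_monoid P)"
    using closed by (rule frag_eval_hom[OF P])
  show "tensor_lift P f \<in> hom (add_monoid T) (add_monoid P)"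
  proof (rule homI)
    fix X assume "X \<in> carrier (add_monoid T)"
    then show "tensor_lift P f X \<in> carrier (add_monoid P)"
      using hom_in_carrier[OF hom tensor_rep_in_free] by (simp add: tensor_lift_def)
  next
    fix X Y assume "X \<in> carrier (add_monoid T)" "Y \<in> carrier (add_monoid T)"
    then have X: "X \<in> carrier T" and Y: "Y \<in> carrier T" by simp_all
    let ?u = "tensor_rep X" and ?v = "tensor_rep Y"
    have "X \<oplus>\<^bsub>T\<^esub> Y = tensor_class R M N (?u + ?v)"
      using X Y by (simp add: tensor_class_add tensor_rep_in_free tensor_class_rep)
    then have "tensor_lift P f (X \<oplus>\<^bsub>T\<^esub> Y) = frag_eval P f (?u + ?v)"
      using lift[of "?u + ?v"] X Y by (simp add: tensor_free_add tensor_rep_in_free)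
    also have "\<dots> = frag_eval P f ?u \<oplus>\<^bsub>P\<^esub> frag_eval P f ?v"
      using hom_mult[OF hom tensor_rep_in_free[OF X] tensor_rep_in_free[OF Y]]
      by (simp add: tensor_free_def)
    finally show "tensor_lift P f (X \<otimes>\<^bsub>add_monoid T\<^esub> Y) =
        tensor_lift P f X \<otimes>\<^bsub>add_monoid P\<^esub> tensor_lift P f Y"
      by (simp add: tensor_lift_def)
  qed
  show "tensor_lift P f (pure x y) = f x y" if "x \<in> carrier M" "y \<in> carrier N"
    using that by (simp add: pure_tensor_def lift frag_of_in_tensor_free frag_eval_of[OF P] closed)
qed

text \<open>The scalar multiplication is defined through a representative; as an induced map it is additive
  and computable on pure tensors.\<close>

lemma tensor_smult_eq_lift:
  assumes "k \<in> carrier R" and X: "X \<in> carrier T"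
  shows "k \<odot>\<^bsub>T\<^esub> X = tensor_lift T (\<lambda>a b. pure (k \<odot>\<^bsub>M\<^esub> a) b) X"
proof -
  let ?g = "\<lambda>(a, b). frag_of (k \<odot>\<^bsub>M\<^esub> a, b)"
  note ext = frag_eval_frag_extend[OF tensor_abelian_group, where M = M and N = N and M' = M and N' = N
      and f = pure and h = "\<lambda>a b. frag_of (k \<odot>\<^bsub>M\<^esub> a, b)" and u = "tensor_rep X"]
  have "k \<odot>\<^bsub>T\<^esub> X = tensor_class R M N (frag_extend ?g (tensor_rep X))"
    by (simp add: tensor_def)
  also have "\<dots> = frag_eval T pure (frag_extend ?g (tensor_rep X))"
    using assms by (intro tensor_class_eq_frag_eval ext)
      (simp_all add: pure_tensor_closed frag_of_in_tensor_free tensor_rep_in_free)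
  also have "\<dots> = frag_eval T (\<lambda>a b. frag_eval T pure (frag_of (k \<odot>\<^bsub>M\<^esub> a, b))) (tensor_rep X)"
    using assms by (intro ext)
      (simp_all add: pure_tensor_closed frag_of_in_tensor_free tensor_rep_in_free)
  also have "\<dots> = frag_eval T (\<lambda>a b. pure (k \<odot>\<^bsub>M\<^esub> a) b) (tensor_rep X)"
    using assms by (intro frag_eval_cong[OF tensor_abelian_group, where M = M and N = N])
      (simp_all add: frag_eval_of[OF tensor_abelian_group] pure_tensor_closed tensor_rep_in_free)
  finally show ?thesis
    by (simp add: tensor_lift_def)
qed

lemma
  assumes k: "k \<in> carrier R"
  shows tensor_smult_hom: "(\<lambda>X. k \<odot>\<^bsub>T\<^esub> X) \<in> hom (add_monoid T) (add_monoid T)"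
    and smult_pure_tensor:
      "\<lbrakk>x \<in> carrier M; y \<in> carrier N\<rbrakk> \<Longrightarrow> k \<odot>\<^bsub>T\<^esub> pure x y = pure (k \<odot>\<^bsub>M\<^esub> x) y"
proof -
  let ?f = "\<lambda>a b. pure (k \<odot>\<^bsub>M\<^esub> a) b"
  have bal: "pure (k \<odot>\<^bsub>M\<^esub> (l \<odot>\<^bsub>M\<^esub> x)) y = pure (k \<odot>\<^bsub>M\<^esub> x) (l \<odot>\<^bsub>N\<^esub> y)"
    if "l \<in> carrier R" "x \<in> carrier M" "y \<in> carrier N" for l x y
  proof -
    have "k \<odot>\<^bsub>M\<^esub> (l \<odot>\<^bsub>M\<^esub> x) = l \<odot>\<^bsub>M\<^esub> (k \<odot>\<^bsub>M\<^esub> x)"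
      using k that by (simp add: M.m_comm flip: M.smult_assoc1)
    then show ?thesis
      using k that by (simp add: pure_tensor_balanced)
  qed
  have lift: "tensor_lift T ?f \<in> hom (add_monoid T) (add_monoid T)"
    by (rule tensor_lift_hom[OF tensor_abelian_group])
       (use k in \<open>simp_all add: pure_tensor_closed pure_tensor_add_left pure_tensor_add_right
          M.smult_r_distr bal\<close>)
  show "(\<lambda>X. k \<odot>\<^bsub>T\<^esub> X) \<in> hom (add_monoid T) (add_monoid T)"
  proof (rule homI)
    fix X Y assume "X \<in> carrier (add_monoid T)" "Y \<in> carrier (add_monoid T)"
    then show "k \<odot>\<^bsub>T\<^esub> (X \<otimes>\<^bsub>add_monoid T\<^esub> Y) = (k \<odot>\<^bsub>T\<^esub> X) \<otimes>\<^bsub>add_monoid T\<^esub> (k \<odot>\<^bsub>T\<^esub> Y)"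
      using hom_mult[OF lift, of X Y] k by (simp add: tensor_smult_eq_lift)
  next
    fix X assume "X \<in> carrier (add_monoid T)"
    then show "k \<odot>\<^bsub>T\<^esub> X \<in> carrier (add_monoid T)"
      using hom_in_carrier[OF lift, of X] k by (simp add: tensor_smult_eq_lift)
  qed
  show "k \<odot>\<^bsub>T\<^esub> pure x y = pure (k \<odot>\<^bsub>M\<^esub> x) y" if "x \<in> carrier M" "y \<in> carrier N"
  proof -
    have "tensor_lift T ?f (pure x y) = ?f x y"
      by (rule tensor_lift_balanced_pure[OF tensor_abelian_group])
         (use k that in \<open>simp_all add: pure_tensor_closed pure_tensor_add_left pure_tensor_add_right
            M.smult_r_distr bal\<close>)
    then show ?thesis
      using k that by (simp add: tensor_smult_eq_lift pure_tensor_closed)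
  qed
qed

lemma tensor_module: "module R T"
proof (rule moduleI)
  note closed = hom_in_carrier[OF tensor_smult_hom, simplified]
  note hom = tensor_smult_hom
  show "cring R" by unfold_locales
  show "abelian_group T" by (fact tensor_abelian_group)
  show "k \<odot>\<^bsub>T\<^esub> X \<in> carrier T" if "k \<in> carrier R" "X \<in> carrier T" for k X
    using that by (rule closed)
  show "k \<odot>\<^bsub>T\<^esub> (X \<oplus>\<^bsub>T\<^esub> Y) = k \<odot>\<^bsub>T\<^esub> X \<oplus>\<^bsub>T\<^esub> k \<odot>\<^bsub>T\<^esub> Y"
    if "k \<in> carrier R" "X \<in> carrier T" "Y \<in> carrier T" for k X Y
    using hom_mult[OF tensor_smult_hom, of k X Y] that by simp
  show "(k \<oplus>\<^bsub>R\<^esub> l) \<odot>\<^bsub>T\<^esub> X = k \<odot>\<^bsub>T\<^esub> X \<oplus>\<^bsub>T\<^esub> l \<odot>\<^bsub>T\<^esub> X"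
    if kl: "k \<in> carrier R" "l \<in> carrier R" and X: "X \<in> carrier T" for k l X
  proof (rule hom_tensor_eqI[OF T.a_group _ _ _ X])
    show "(\<lambda>X. (k \<oplus>\<^bsub>R\<^esub> l) \<odot>\<^bsub>T\<^esub> X) \<in> hom (add_monoid T) (add_monoid T)"
      using kl by (intro hom) simp
    show "(\<lambda>X. k \<odot>\<^bsub>T\<^esub> X \<oplus>\<^bsub>T\<^esub> l \<odot>\<^bsub>T\<^esub> X) \<in> hom (add_monoid T) (add_monoid T)"
      using hom_mult[OF hom] closed kl by (intro homI) (simp_all add: T.a_ac)
  qed (use kl in \<open>simp_all add: smult_pure_tensor M.smult_l_distr pure_tensor_add_left\<close>)
  show "(k \<otimes>\<^bsub>R\<^esub> l) \<odot>\<^bsub>T\<^esub> X = k \<odot>\<^bsub>T\<^esub> (l \<odot>\<^bsub>T\<^esub> X)"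
    if kl: "k \<in> carrier R" "l \<in> carrier R" and X: "X \<in> carrier T" for k l X
  proof (rule hom_tensor_eqI[OF T.a_group _ _ _ X])
    show "(\<lambda>X. (k \<otimes>\<^bsub>R\<^esub> l) \<odot>\<^bsub>T\<^esub> X) \<in> hom (add_monoid T) (add_monoid T)"
      using kl by (intro hom) simp
    show "(\<lambda>X. k \<odot>\<^bsub>T\<^esub> (l \<odot>\<^bsub>T\<^esub> X)) \<in> hom (add_monoid T) (add_monoid T)"
      using hom_compose[OF hom[OF kl(2)] hom[OF kl(1)]] by (simp add: comp_def)
  qed (use kl in \<open>simp_all add: smult_pure_tensor M.smult_assoc1\<close>)
  show "\<one>\<^bsub>R\<^esub> \<odot>\<^bsub>T\<^esub> X = X" if X: "X \<in> carrier T" for X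
  proof (rule hom_tensor_eqI[OF T.a_group _ _ _ X])
    show "(\<lambda>X. \<one>\<^bsub>R\<^esub> \<odot>\<^bsub>T\<^esub> X) \<in> hom (add_monoid T) (add_monoid T)"
      by (intro hom) simp
    show "(\<lambda>X. X) \<in> hom (add_monoid T) (add_monoid T)"
      by (auto intro: homI)
  qed (simp_all add: smult_pure_tensor)
qed

end

section \<open>Lifting bilinear maps\<close>

context
  fixes R :: "('r, 'x) ring_scheme"
    and M :: "('r, 'm, 'y) module_scheme" and N :: "('r, 'n, 'z) module_scheme"
  assumes M: "module R M" and N: "module R N"
begin

lemma pure_tensor_linear_left:
  assumes h: "h \<in> linear_maps R Q M" and y: "y \<in> carrier N"
  shows "(\<lambda>x. pure_tensor R M N (h x) y) \<in> linear_maps R Q (tensor R M N)"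
proof -
  have "(\<lambda>x. pure_tensor R M N x y) \<in> linear_maps R M (tensor R M N)"
    using y by (intro linear_mapsI)
      (simp_all add: pure_tensor_closed[OF M N] pure_tensor_add_left[OF M N] smult_pure_tensor[OF M N])
  from linear_maps_comp[OF this h] show ?thesis .
qed

lemma pure_tensor_linear_right:
  assumes h: "h \<in> linear_maps R Q N" and x: "x \<in> carrier M"
  shows "(\<lambda>y. pure_tensor R M N x (h y)) \<in> linear_maps R Q (tensor R M N)"
proof -
  have "(\<lambda>y. pure_tensor R M N x y) \<in> linear_maps R N (tensor R M N)"
    using x by (intro linear_mapsI)
      (simp_all add: pure_tensor_closed[OF M N] pure_tensor_add_right[OF M N]
        smult_pure_tensor[OF M N] pure_tensor_balanced[OF M N])
  from linear_maps_comp[OF this h] show ?thesis .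
qed

lemma linear_maps_tensor_eqI:
  assumes "abelian_group P" and f: "f \<in> linear_maps R (tensor R M N) P"
    and g: "g \<in> linear_maps R (tensor R M N) P"
    and "\<And>x y. \<lbrakk>x \<in> carrier M; y \<in> carrier N\<rbrakk>
      \<Longrightarrow> f (pure_tensor R M N x y) = g (pure_tensor R M N x y)"
    and "X \<in> carrier (tensor R M N)"
  shows "f X = g X"
  using hom_tensor_eqI[OF M N abelian_group.a_group[OF assms(1)] linear_maps_hom[OF f]
      linear_maps_hom[OF g]] assms by simp

lemma tensor_lift_pure:
  assumes P: "module R P" and f: "f \<in> bilinear_maps R M N P"
    and "x \<in> carrier M" "y \<in> carrier N"
  shows "tensor_lift P f (pure_tensor R M N x y) = f x y"
proof -
  interpret P: module R P by fact
  note l = bilinear_maps_left[OF f] and r = bilinear_maps_right[OF f]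
  show ?thesis
    by (rule tensor_lift_balanced_pure[OF M N P.abelian_group_axioms])
       (use assms in \<open>simp_all add: bilinear_maps_closed linear_maps_add[OF l] linear_maps_add[OF r]
          linear_maps_smult[OF l] linear_maps_smult[OF r]\<close>)
qed

lemma tensor_lift_linear:
  assumes P: "module R P" and f: "f \<in> bilinear_maps R M N P"
  shows "tensor_lift P f \<in> linear_maps R (tensor R M N) P"
proof -
  interpret P: module R P by fact
  interpret T: module R "tensor R M N" by (rule tensor_module[OF M N])
  note l = bilinear_maps_left[OF f] and r = bilinear_maps_right[OF f]
  have hom: "tensor_lift P f \<in> hom (add_monoid (tensor R M N)) (add_monoid P)"
    by (rule tensor_lift_hom[OF M N P.abelian_group_axioms])
       (use assms in \<open>simp_all add: bilinear_maps_closed linear_maps_add[OF l] linear_maps_add[OF r]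
          linear_maps_smult[OF l] linear_maps_smult[OF r]\<close>)
  have smult: "tensor_lift P f (k \<odot>\<^bsub>tensor R M N\<^esub> X) = k \<odot>\<^bsub>P\<^esub> tensor_lift P f X"
    if k: "k \<in> carrier R" and X: "X \<in> carrier (tensor R M N)" for k X
  proof (rule hom_tensor_eqI[OF M N P.a_group _ _ _ X])
    show "(\<lambda>X. tensor_lift P f (k \<odot>\<^bsub>tensor R M N\<^esub> X)) \<in> hom (add_monoid (tensor R M N)) (add_monoid P)"
      using hom_compose[OF tensor_smult_hom[OF M N k] hom] by (simp add: comp_def)
    show "(\<lambda>X. k \<odot>\<^bsub>P\<^esub> tensor_lift P f X) \<in> hom (add_monoid (tensor R M N)) (add_monoid P)"
      using hom_mult[OF hom] hom_in_carrier[OF hom] k by (intro homI) (simp_all add: P.smult_r_distr)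
    fix x y assume xy: "x \<in> carrier M" "y \<in> carrier N"
    then have "k \<odot>\<^bsub>M\<^esub> x \<in> carrier M"
      using k module.smult_closed[OF M] by blast
    then show "tensor_lift P f (k \<odot>\<^bsub>tensor R M N\<^esub> pure_tensor R M N x y)
        = k \<odot>\<^bsub>P\<^esub> tensor_lift P f (pure_tensor R M N x y)"
      using k xy by (simp add: smult_pure_tensor[OF M N] tensor_lift_pure[OF P f] linear_maps_smult[OF l])
  qed
  show ?thesis
    using hom smult by (simp add: linear_maps_def)
qed

lemma tensor_lift_linear_argument:
  assumes "module R P" "f \<in> bilinear_maps R M N P" "h \<in> linear_maps R Q (tensor R M N)"
  shows "(\<lambda>z. tensor_lift P f (h z)) \<in> linear_maps R Q P"
  using linear_maps_comp[OF tensor_lift_linear[OF assms(1,2)] assms(3)] .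

context
  fixes X assumes X: "X \<in> carrier (tensor R M N)"
begin

lemma tensor_lift_closed:
  assumes P: "module R P" and "\<And>x y. \<lbrakk>x \<in> carrier M; y \<in> carrier N\<rbrakk> \<Longrightarrow> f x y \<in> carrier P"
  shows "tensor_lift P f X \<in> carrier P"
  unfolding tensor_lift_def
  by (rule frag_eval_in_carrier[OF module.axioms(2)[OF P] _ tensor_rep_in_free[OF M N X]]) (rule assms(2))

lemma tensor_lift_cong:
  assumes P: "module R P" and "\<And>x y. \<lbrakk>x \<in> carrier M; y \<in> carrier N\<rbrakk> \<Longrightarrow> f x y = g x y"
    and "\<And>x y. \<lbrakk>x \<in> carrier M; y \<in> carrier N\<rbrakk> \<Longrightarrow> g x y \<in> carrier P"
  shows "tensor_lift P f X = tensor_lift P g X"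
  unfolding tensor_lift_def
  by (rule frag_eval_cong[OF module.axioms(2)[OF P] _ _ tensor_rep_in_free[OF M N X]])
     (simp_all add: assms(2,3))

lemma linear_map_tensor_lift:
  assumes P: "module R P" and Q: "module R Q" and g: "g \<in> linear_maps R P Q"
    and "\<And>x y. \<lbrakk>x \<in> carrier M; y \<in> carrier N\<rbrakk> \<Longrightarrow> f x y \<in> carrier P"
  shows "g (tensor_lift P f X) = tensor_lift Q (\<lambda>x y. g (f x y)) X"
  unfolding tensor_lift_def
  by (rule frag_eval_image[OF module.axioms(2)[OF P] module.axioms(2)[OF Q] linear_maps_hom[OF g] _
        tensor_rep_in_free[OF M N X]]) (rule assms(4))

text \<open>Linearity in a parameter of the summands: as \<open>X\<close> is fixed, so is the representative over which the
  sum is taken, and the sum is a fixed integer combination of linear maps.\<close>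

lemma tensor_lift_linear_body:
  assumes P: "module R P"
    and f: "\<And>x y. \<lbrakk>x \<in> carrier M; y \<in> carrier N\<rbrakk> \<Longrightarrow> (\<lambda>z. f z x y) \<in> linear_maps R Q P"
  shows "(\<lambda>z. tensor_lift P (f z) X) \<in> linear_maps R Q P"
proof -
  interpret P: module R P by fact
  note closed = linear_maps_closed[OF f]
  show ?thesis
  proof (rule linear_mapsI)
    fix z assume "z \<in> carrier Q"
    then show "tensor_lift P (f z) X \<in> carrier P"
      by (intro tensor_lift_closed[OF P] closed)
  next
    fix z w assume z: "z \<in> carrier Q" and w: "w \<in> carrier Q"
    have "tensor_lift P (f (z \<oplus>\<^bsub>Q\<^esub> w)) X = tensor_lift P (\<lambda>x y. f z x y \<oplus>\<^bsub>P\<^esub> f w x y) X"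
      using z w by (intro tensor_lift_cong[OF P]) (simp_all add: linear_maps_add[OF f] closed)
    also have "\<dots> = tensor_lift P (f z) X \<oplus>\<^bsub>P\<^esub> tensor_lift P (f w) X"
      unfolding tensor_lift_def
      using z w frag_eval_pointwise_add[OF P.abelian_group_axioms, of M N "f z" "f w", OF _ _
          tensor_rep_in_free[OF M N X]] closed by simp
    finally show "tensor_lift P (f (z \<oplus>\<^bsub>Q\<^esub> w)) X = tensor_lift P (f z) X \<oplus>\<^bsub>P\<^esub> tensor_lift P (f w) X" .
  next
    fix k z assume k: "k \<in> carrier R" and z: "z \<in> carrier Q"
    have "tensor_lift P (f (k \<odot>\<^bsub>Q\<^esub> z)) X = tensor_lift P (\<lambda>x y. k \<odot>\<^bsub>P\<^esub> f z x y) X"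
      using k z by (intro tensor_lift_cong[OF P]) (simp_all add: linear_maps_smult[OF f] closed)
    also have "\<dots> = k \<odot>\<^bsub>P\<^esub> tensor_lift P (f z) X"
    proof (rule linear_map_tensor_lift[OF P P, symmetric])
      show "(\<lambda>p. k \<odot>\<^bsub>P\<^esub> p) \<in> linear_maps R P P"
        using k by (intro linear_mapsI)
          (simp_all add: P.smult_r_distr P.R.m_comm flip: P.smult_assoc1)
    qed (use z closed in auto)
    finally show "tensor_lift P (f (k \<odot>\<^bsub>Q\<^esub> z)) X = k \<odot>\<^bsub>P\<^esub> tensor_lift P (f z) X" .
  qed
qed

end

text \<open>The nested sum on the right runs over the very representatives of \<open>X\<close> and \<open>Y\<close> by which the
  product is defined, and bilinearity of \<open>f\<close> makes the lift on the left independent of the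
  representative of the product.\<close>

lemma tensor_lift_mult:
  assumes P: "module R P" and f: "f \<in> bilinear_maps R M N P"
    and mM: "\<And>a b. \<lbrakk>a \<in> carrier M; b \<in> carrier M\<rbrakk> \<Longrightarrow> a \<otimes>\<^bsub>M\<^esub> b \<in> carrier M"
    and mN: "\<And>a b. \<lbrakk>a \<in> carrier N; b \<in> carrier N\<rbrakk> \<Longrightarrow> a \<otimes>\<^bsub>N\<^esub> b \<in> carrier N"
    and X: "X \<in> carrier (tensor R M N)" and Y: "Y \<in> carrier (tensor R M N)"
  shows "tensor_lift P f (X \<otimes>\<^bsub>tensor R M N\<^esub> Y) =
    tensor_lift P (\<lambda>a b. tensor_lift P (\<lambda>c d. f (a \<otimes>\<^bsub>M\<^esub> c) (b \<otimes>\<^bsub>N\<^esub> d)) Y) X"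
proof -
  interpret P: module R P by fact
  note ag = P.abelian_group_axioms
  note l = bilinear_maps_left[OF f] and r = bilinear_maps_right[OF f]
  note closed = bilinear_maps_closed[OF f]
  let ?F = "tensor_free M N" and ?u = "tensor_rep X" and ?v = "tensor_rep Y"
  have u: "?u \<in> carrier ?F" and v: "?v \<in> carrier ?F"
    using X Y by (simp_all add: tensor_rep_in_free[OF M N])
  let ?w = "\<lambda>a b. frag_extend (\<lambda>(c, d). frag_of (a \<otimes>\<^bsub>M\<^esub> c, b \<otimes>\<^bsub>N\<^esub> d)) ?v"
  have inner: "?w a b \<in> carrier ?F"
    "frag_eval P f (?w a b) = frag_eval P (\<lambda>c d. f (a \<otimes>\<^bsub>M\<^esub> c) (b \<otimes>\<^bsub>N\<^esub> d)) ?v"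
    if ab: "a \<in> carrier M" "b \<in> carrier N" for a b
  proof -
    note ext = frag_eval_frag_extend[OF ag, where M = M and N = N and M' = M and N' = N and f = f
        and h = "\<lambda>c d. frag_of (a \<otimes>\<^bsub>M\<^esub> c, b \<otimes>\<^bsub>N\<^esub> d)" and u = ?v]
    show "?w a b \<in> carrier ?F"
      using ab v by (intro ext) (simp_all add: closed frag_of_in_tensor_free[OF M N] mM mN)
    have "frag_eval P f (?w a b) = frag_eval P (\<lambda>c d. frag_eval P f (frag_of (a \<otimes>\<^bsub>M\<^esub> c, b \<otimes>\<^bsub>N\<^esub> d))) ?v"
      using ab v by (intro ext) (simp_all add: closed frag_of_in_tensor_free[OF M N] mM mN)
    also have "\<dots> = frag_eval P (\<lambda>c d. f (a \<otimes>\<^bsub>M\<^esub> c) (b \<otimes>\<^bsub>N\<^esub> d)) ?v"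
      using ab v by (intro frag_eval_cong[OF ag, where M = M and N = N])
        (simp_all add: frag_eval_of[OF ag] closed mM mN)
    finally show "frag_eval P f (?w a b) = \<dots>" .
  qed
  note ext = frag_eval_frag_extend[OF ag, where M = M and N = N and M' = M and N' = N and f = f
      and h = ?w and u = ?u]
  have "tensor_lift P f (X \<otimes>\<^bsub>tensor R M N\<^esub> Y) =
      tensor_lift P f (tensor_class R M N (frag_extend (\<lambda>(a, b). ?w a b) ?u))"
    by (simp add: tensor_def)
  also have "\<dots> = frag_eval P f (frag_extend (\<lambda>(a, b). ?w a b) ?u)"
  proof (rule tensor_lift_class[OF M N ag])
    show "frag_extend (\<lambda>(a, b). ?w a b) ?u \<in> carrier ?F"
      by (rule ext) (simp_all add: closed inner u)
  qed (simp_all add: closed linear_maps_add[OF l] linear_maps_add[OF r]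
      linear_maps_smult[OF l] linear_maps_smult[OF r])
  also have "\<dots> = frag_eval P (\<lambda>a b. frag_eval P f (?w a b)) ?u"
    by (rule ext) (simp_all add: closed inner u)
  also have "\<dots> = frag_eval P (\<lambda>a b. frag_eval P (\<lambda>c d. f (a \<otimes>\<^bsub>M\<^esub> c) (b \<otimes>\<^bsub>N\<^esub> d)) ?v) ?u"
    using u v by (intro frag_eval_cong[OF ag, where M = M and N = N])
      (simp_all add: inner frag_eval_in_carrier[OF ag, where M = M and N = N] closed mM mN)
  finally show ?thesis
    by (simp add: tensor_lift_def)
qed

end

lemma tensor_lift_swap:
  assumes "module R M" "module R N" "module R M'" "module R N'" "module R P"
    and "X \<in> carrier (tensor R M N)" "Y \<in> carrier (tensor R M' N')"
    and "\<And>x y a b. \<lbrakk>x \<in> carrier M; y \<in> carrier N; a \<in> carrier M'; b \<in> carrier N'\<rbrakk>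
      \<Longrightarrow> f x y a b \<in> carrier P"
  shows "tensor_lift P (\<lambda>x y. tensor_lift P (f x y) Y) X =
    tensor_lift P (\<lambda>a b. tensor_lift P (\<lambda>x y. f x y a b) X) Y"
  unfolding tensor_lift_def
  by (rule frag_eval_swap[OF module.axioms(2)[OF assms(5)] _
        tensor_rep_in_free[OF assms(1,2,6)] tensor_rep_in_free[OF assms(3,4,7)]]) (rule assms(8))

section \<open>Sweedler calculus\<close>

lemma (in assoc_algebra) mult_linear_left:
  assumes h: "h \<in> linear_maps R Q A" and c: "c \<in> carrier A"
  shows "(\<lambda>x. h x \<otimes>\<^bsub>A\<^esub> c) \<in> linear_maps R Q A"
proof -
  have "(\<lambda>x. x \<otimes>\<^bsub>A\<^esub> c) \<in> linear_maps R A A"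
    using c by (intro linear_mapsI) (simp_all add: l_distr smult_mult_left)
  from linear_maps_comp[OF this h] show ?thesis .
qed

lemma (in assoc_algebra) mult_linear_right:
  assumes h: "h \<in> linear_maps R Q A" and c: "c \<in> carrier A"
  shows "(\<lambda>x. c \<otimes>\<^bsub>A\<^esub> h x) \<in> linear_maps R Q A"
proof -
  have "(\<lambda>x. c \<otimes>\<^bsub>A\<^esub> x) \<in> linear_maps R A A"
    using c by (intro linear_mapsI) (simp_all add: r_distr smult_mult_right)
  from linear_maps_comp[OF this h] show ?thesis .
qed

lemma algebra_imp_assoc_algebra:
  assumes "algebra R S"
  shows "assoc_algebra R S"
proof -
  interpret S: algebra R S by fact
  show ?thesis
  proof (intro assoc_algebra.intro assoc_algebra_axioms.intro S.module_axioms S.ring_axioms)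
    fix k x y assume k: "k \<in> carrier R" and x: "x \<in> carrier S" and y: "y \<in> carrier S"
    then show "k \<odot>\<^bsub>S\<^esub> x \<otimes>\<^bsub>S\<^esub> y = k \<odot>\<^bsub>S\<^esub> (x \<otimes>\<^bsub>S\<^esub> y)"
      by (rule S.smult_assoc2)
    show "x \<otimes>\<^bsub>S\<^esub> (k \<odot>\<^bsub>S\<^esub> y) = k \<odot>\<^bsub>S\<^esub> (x \<otimes>\<^bsub>S\<^esub> y)"
      using k x y by (simp add: S.m_comm[of x] S.smult_assoc2 S.smult_closed)
  qed
qed

context bialgebra
begin

abbreviation sweedler where
  "sweedler P f a \<equiv> tensor_lift P f (comult a)"

text \<open>The threefold sum splits the second leg, so that cocommutativity applied to the inner sum
  exchanges the last two legs.\<close>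

abbreviation sweedler3 where
  "sweedler3 P f a \<equiv> sweedler P (\<lambda>x y. sweedler P (\<lambda>u v. f x u v) y) a"

lemma module_M: "module R M"
  by unfold_locales

lemma comult_closed: "a \<in> carrier M \<Longrightarrow> comult a \<in> carrier (tensor R M M)"
  using comult_linear by (rule linear_maps_closed)

lemma sweedler_closed:
  assumes "module R P" "a \<in> carrier M"
    and "\<And>x y. \<lbrakk>x \<in> carrier M; y \<in> carrier M\<rbrakk> \<Longrightarrow> f x y \<in> carrier P"
  shows "sweedler P f a \<in> carrier P"
  using assms by (intro tensor_lift_closed[OF module_M module_M comult_closed])

lemma sweedler_linear_body:
  assumes "module R P" "a \<in> carrier M"
    and "\<And>x y. \<lbrakk>x \<in> carrier M; y \<in> carrier M\<rbrakk> \<Longrightarrow> (\<lambda>z. f z x y) \<in> linear_maps R Q P"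
  shows "(\<lambda>z. sweedler P (f z) a) \<in> linear_maps R Q P"
  using assms by (intro tensor_lift_linear_body[OF module_M module_M comult_closed])

lemma sweedler_linear_argument:
  assumes "module R P" "f \<in> bilinear_maps R M M P" "h \<in> linear_maps R Q M"
  shows "(\<lambda>z. sweedler P f (h z)) \<in> linear_maps R Q P"
  using assms by (intro tensor_lift_linear_argument[OF module_M module_M] linear_maps_comp[OF comult_linear])

text \<open>Rules whose conclusions are selected by the outermost operation above the distinguished
  variable. Their repeated application proves that an expression in which each variable occurs once
  is linear in a given variable.\<close>

lemmas multilinear_intros =
  bilinear_mapsI linear_maps_id pure_tensor_linear_left pure_tensor_linear_right
  sweedler_linear_argument linear_maps_comp[OF comult_linear]
  sweedler_linear_body sweedler_closed
  mult_linear_left mult_linear_right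
  pure_tensor_closed comult_closed m_closed tensor_module module_M

lemma sweedler_cong:
  assumes "module R P" "a \<in> carrier M"
    and "\<And>x y. \<lbrakk>x \<in> carrier M; y \<in> carrier M\<rbrakk> \<Longrightarrow> f x y = g x y"
    and "\<And>x y. \<lbrakk>x \<in> carrier M; y \<in> carrier M\<rbrakk> \<Longrightarrow> g x y \<in> carrier P"
  shows "sweedler P f a = sweedler P g a"
  using assms by (intro tensor_lift_cong[OF module_M module_M comult_closed])

lemma linear_map_sweedler:
  assumes "module R P" "module R Q" "g \<in> linear_maps R P Q" "a \<in> carrier M"
    and "\<And>x y. \<lbrakk>x \<in> carrier M; y \<in> carrier M\<rbrakk> \<Longrightarrow> f x y \<in> carrier P"
  shows "g (sweedler P f a) = sweedler Q (\<lambda>x y. g (f x y)) a"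
  using assms by (intro linear_map_tensor_lift[OF module_M module_M comult_closed])

text \<open>Both sides are images of the two sides of the coassociativity axiom under the linear map that
  \<open>f\<close> induces on \<open>M \<otimes> (M \<otimes> M)\<close>.\<close>

lemma sweedler_coassoc:
  assumes P: "module R P" and a: "a \<in> carrier M"
    and f: "\<And>y z. \<lbrakk>y \<in> carrier M; z \<in> carrier M\<rbrakk> \<Longrightarrow> (\<lambda>x. f x y z) \<in> linear_maps R M P"
      "\<And>x z. \<lbrakk>x \<in> carrier M; z \<in> carrier M\<rbrakk> \<Longrightarrow> (\<lambda>y. f x y z) \<in> linear_maps R M P"
      "\<And>x y. \<lbrakk>x \<in> carrier M; y \<in> carrier M\<rbrakk> \<Longrightarrow> (\<lambda>z. f x y z) \<in> linear_maps R M P"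
  shows "sweedler P (\<lambda>x y. sweedler P (\<lambda>u v. f u v y) x) a = sweedler3 P f a"
proof -
  let ?MM = "tensor R M M" and ?MMM = "tensor R M (tensor R M M)"
  note intros = multilinear_intros f P linear_maps_closed[OF f(1)]
  define g where "g = tensor_lift P (\<lambda>x Y. tensor_lift P (f x) Y)"
  have inner: "(\<lambda>x Y. tensor_lift P (f x) Y) \<in> bilinear_maps R M ?MM P"
    by (intro intros tensor_lift_linear_argument[OF module_M module_M] tensor_lift_linear_body[OF module_M module_M])
  have g: "g \<in> linear_maps R ?MMM P"
    unfolding g_def by (intro tensor_lift_linear inner intros)
  have g_pure: "g (pure_tensor R M ?MM x Y) = tensor_lift P (f x) Y"
    if "x \<in> carrier M" "Y \<in> carrier ?MM" for x Y
    unfolding g_def using that by (intro tensor_lift_pure inner P intros)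
  have f_pure: "tensor_lift P (f x) (pure_tensor R M M y z) = f x y z"
    if "x \<in> carrier M" "y \<in> carrier M" "z \<in> carrier M" for x y z
    using that by (intro tensor_lift_pure intros)
  have g_closed: "g Z \<in> carrier P" if "Z \<in> carrier ?MMM" for Z
    using g that by (rule linear_maps_closed)
  note image = linear_map_sweedler[OF _ P g]
  have "sweedler3 P f a = sweedler P (\<lambda>x y. g (pure_tensor R M ?MM x (comult y))) a"
    using a by (intro sweedler_cong g_pure[symmetric] g_closed intros)
  also have "\<dots> = g (sweedler ?MMM (\<lambda>x y. pure_tensor R M ?MM x (comult y)) a)"
    using a by (intro image[symmetric] intros)
  also have "\<dots> = g (sweedler ?MMM (\<lambda>x y. sweedler ?MMM (\<lambda>u v. pure_tensor R M ?MM u (pure_tensor R M M v y)) x) a)"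
    using coassoc[OF a] by simp
  also have "\<dots> = sweedler P (\<lambda>x y. g (sweedler ?MMM (\<lambda>u v. pure_tensor R M ?MM u (pure_tensor R M M v y)) x)) a"
    using a by (intro image intros)
  also have "\<dots> = sweedler P (\<lambda>x y. sweedler P (\<lambda>u v. g (pure_tensor R M ?MM u (pure_tensor R M M v y))) x) a"
    using a by (intro sweedler_cong image g_closed intros)
  also have "\<dots> = sweedler P (\<lambda>x y. sweedler P (\<lambda>u v. f u v y) x) a"
    using a by (intro sweedler_cong intros) (simp_all add: g_pure f_pure pure_tensor_closed module_M)
  finally show ?thesis by simp
qed

lemma sweedler_mult:
  assumes "module R P" "f \<in> bilinear_maps R M M P" "a \<in> carrier M" "b \<in> carrier M"
  shows "sweedler P f (a \<otimes>\<^bsub>M\<^esub> b) =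
    sweedler P (\<lambda>x y. sweedler P (\<lambda>u v. f (x \<otimes>\<^bsub>M\<^esub> u) (y \<otimes>\<^bsub>M\<^esub> v)) b) a"
  using assms ring_hom_mult[OF comult_hom]
  by (simp add: tensor_lift_mult module_M comult_closed)

lemma sweedler_one:
  assumes "module R P" "f \<in> bilinear_maps R M M P"
  shows "sweedler P f \<one>\<^bsub>M\<^esub> = f \<one>\<^bsub>M\<^esub> \<one>\<^bsub>M\<^esub>"
  using assms ring_hom_one[OF comult_hom] one_closed
  by (simp add: tensor_def tensor_lift_pure module_M)

lemma sweedler_swap:
  assumes "module R P" "a \<in> carrier M" "b \<in> carrier M"
    and "\<And>x y u v. \<lbrakk>x \<in> carrier M; y \<in> carrier M; u \<in> carrier M; v \<in> carrier M\<rbrakk>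
      \<Longrightarrow> f x y u v \<in> carrier P"
  shows "sweedler P (\<lambda>x y. sweedler P (f x y) b) a = sweedler P (\<lambda>u v. sweedler P (\<lambda>x y. f x y u v) a) b"
  using assms
  by (intro tensor_lift_swap[OF module_M module_M module_M module_M] comult_closed)

text \<open>This is the shape in which an iterated twisted product appears: \<open>\<Delta>\<close> of a product \<open>x u\<close> of first
  legs splits both \<open>x\<close> and \<open>u\<close>. After interchanging the two middle sums, coassociativity applies to
  \<open>a\<close> and \<open>b\<close> separately.\<close>

lemma sweedler_pair_coassoc:
  assumes P: "module R P" and a: "a \<in> carrier M" and b: "b \<in> carrier M"
    and f: "\<And>x2 x3 u1 u2 u3. \<lbrakk>x2 \<in> carrier M; x3 \<in> carrier M; u1 \<in> carrier M; u2 \<in> carrier M; u3 \<in> carrier M\<rbrakk>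
        \<Longrightarrow> (\<lambda>z. f z x2 x3 u1 u2 u3) \<in> linear_maps R M P"
      "\<And>x1 x3 u1 u2 u3. \<lbrakk>x1 \<in> carrier M; x3 \<in> carrier M; u1 \<in> carrier M; u2 \<in> carrier M; u3 \<in> carrier M\<rbrakk>
        \<Longrightarrow> (\<lambda>z. f x1 z x3 u1 u2 u3) \<in> linear_maps R M P"
      "\<And>x1 x2 u1 u2 u3. \<lbrakk>x1 \<in> carrier M; x2 \<in> carrier M; u1 \<in> carrier M; u2 \<in> carrier M; u3 \<in> carrier M\<rbrakk>
        \<Longrightarrow> (\<lambda>z. f x1 x2 z u1 u2 u3) \<in> linear_maps R M P"
      "\<And>x1 x2 x3 u2 u3. \<lbrakk>x1 \<in> carrier M; x2 \<in> carrier M; x3 \<in> carrier M; u2 \<in> carrier M; u3 \<in> carrier M\<rbrakk>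
        \<Longrightarrow> (\<lambda>z. f x1 x2 x3 z u2 u3) \<in> linear_maps R M P"
      "\<And>x1 x2 x3 u1 u3. \<lbrakk>x1 \<in> carrier M; x2 \<in> carrier M; x3 \<in> carrier M; u1 \<in> carrier M; u3 \<in> carrier M\<rbrakk>
        \<Longrightarrow> (\<lambda>z. f x1 x2 x3 u1 z u3) \<in> linear_maps R M P"
      "\<And>x1 x2 x3 u1 u2. \<lbrakk>x1 \<in> carrier M; x2 \<in> carrier M; x3 \<in> carrier M; u1 \<in> carrier M; u2 \<in> carrier M\<rbrakk>
        \<Longrightarrow> (\<lambda>z. f x1 x2 x3 u1 u2 z) \<in> linear_maps R M P"
  shows "sweedler P (\<lambda>x y. sweedler P (\<lambda>u v.
      sweedler P (\<lambda>x1 x2. sweedler P (\<lambda>u1 u2. f x1 x2 y u1 u2 v) u) x) b) a =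
    sweedler3 P (\<lambda>x1 x2 x3. sweedler3 P (\<lambda>u1 u2 u3. f x1 x2 x3 u1 u2 u3) b) a"
proof -
  note intros = multilinear_intros f P a b linear_maps_closed[OF f(1)]
  have "sweedler P (\<lambda>x y. sweedler P (\<lambda>u v.
      sweedler P (\<lambda>x1 x2. sweedler P (\<lambda>u1 u2. f x1 x2 y u1 u2 v) u) x) b) a
    = sweedler P (\<lambda>x y. sweedler P (\<lambda>x1 x2.
      sweedler P (\<lambda>u v. sweedler P (\<lambda>u1 u2. f x1 x2 y u1 u2 v) u) b) x) a"
    by (intro sweedler_cong sweedler_swap intros)
  also have "\<dots> = sweedler P (\<lambda>x y. sweedler P (\<lambda>x1 x2. sweedler3 P (f x1 x2 y) b) x) a"
    by (intro sweedler_cong sweedler_coassoc intros)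
  also have "\<dots> = sweedler3 P (\<lambda>x1 x2 x3. sweedler3 P (\<lambda>u1 u2 u3. f x1 x2 x3 u1 u2 u3) b) a"
    by (intro sweedler_coassoc intros)
  finally show ?thesis .
qed

lemma sweedler_sweedler3_swap:
  assumes P: "module R P" and a: "a \<in> carrier M" and b: "b \<in> carrier M"
    and f: "\<And>x y u v w. \<lbrakk>x \<in> carrier M; y \<in> carrier M; u \<in> carrier M; v \<in> carrier M; w \<in> carrier M\<rbrakk>
      \<Longrightarrow> f x y u v w \<in> carrier P"
  shows "sweedler3 P (\<lambda>u v w. sweedler P (\<lambda>x y. f x y u v w) a) b =
    sweedler P (\<lambda>x y. sweedler3 P (\<lambda>u v w. f x y u v w) b) a"
proof -
  note intros = multilinear_intros f P a b
  have "sweedler3 P (\<lambda>u v w. sweedler P (\<lambda>x y. f x y u v w) a) b =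
      sweedler P (\<lambda>u t. sweedler P (\<lambda>x y. sweedler P (\<lambda>v w. f x y u v w) t) a) b"
    by (intro sweedler_cong sweedler_swap intros)
  also have "\<dots> = sweedler P (\<lambda>x y. sweedler3 P (\<lambda>u v w. f x y u v w) b) a"
    by (intro sweedler_swap intros)
  finally show ?thesis .
qed

end

text \<open>The image of the cocommutativity axiom under the map induced by \<open>f\<close>.\<close>

lemma (in cocommutative_bialgebra) sweedler_cocommute:
  assumes P: "module R P" and f: "f \<in> bilinear_maps R M M P" and a: "a \<in> carrier M"
  shows "sweedler P (\<lambda>x y. f y x) a = sweedler P f a"
proof -
  note intros = multilinear_intros P a
  have "sweedler P f a = tensor_lift P f (sweedler (tensor R M M) (\<lambda>x y. pure_tensor R M M y x) a)"
    using cocommutative[OF a] by simp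
  also have "\<dots> = sweedler P (\<lambda>x y. tensor_lift P f (pure_tensor R M M y x)) a"
    by (intro linear_map_sweedler tensor_lift_linear f intros)
  also have "\<dots> = sweedler P (\<lambda>x y. f y x) a"
    by (intro sweedler_cong tensor_lift_pure bilinear_maps_closed[OF f] f intros)
  finally show ?thesis by simp
qed

section \<open>The twisted product\<close>

locale bicharacter_twist = cocommutative_bialgebra R M comult counit + bicharacter R M comult counit S r
  for R (structure) and M (structure) and comult counit and S (structure) and r
begin

abbreviation T where "T \<equiv> tensor R M S"
abbreviation pure where "pure \<equiv> pure_tensor R M S"
abbreviation \<rho> where "\<rho> x y \<equiv> r (pure_tensor R M M x y)"
abbreviation twisted (infixl "\<star>" 70) where "X \<star> Y \<equiv> twisted_mult R M comult S r X Y"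

lemma S_assoc_algebra: "assoc_algebra R S"
  by (rule algebra_imp_assoc_algebra) unfold_locales

lemma module_S: "module R S"
  by unfold_locales

lemmas module_T = tensor_module[OF module_M module_S]

lemmas r_closed = linear_maps_closed[OF linear]

text \<open>The order matters: a lift over \<open>M \<otimes> S\<close> has the same outermost operation as a Sweedler sum, so
  the more specific rules for Sweedler sums, contained in \<open>multilinear_intros\<close>, come first.\<close>

lemmas twist_intros = multilinear_intros module_S
  assoc_algebra.mult_linear_left[OF S_assoc_algebra] assoc_algebra.mult_linear_right[OF S_assoc_algebra]
  S.m_closed S.one_closed one_closed r_closed linear_maps_comp[OF linear]
  tensor_lift_linear_argument[OF module_M module_S] tensor_lift_linear_body[OF module_M module_S]
  tensor_lift_closed[OF module_M module_S]

lemma twisted_linear_left: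
  assumes "h \<in> linear_maps R Q T" "Y \<in> carrier T"
  shows "(\<lambda>z. h z \<star> Y) \<in> linear_maps R Q T"
  unfolding twisted_mult_def scalar_ext_smult_def twisted_prod_def
  using assms by (intro twist_intros)

lemma twisted_linear_right:
  assumes "h \<in> linear_maps R Q T" "X \<in> carrier T"
  shows "(\<lambda>z. X \<star> h z) \<in> linear_maps R Q T"
  unfolding twisted_mult_def scalar_ext_smult_def twisted_prod_def
  using assms by (intro twist_intros)

lemma twisted_closed:
  assumes "X \<in> carrier T" "Y \<in> carrier T"
  shows "X \<star> Y \<in> carrier T"
  using linear_maps_closed[OF twisted_linear_left[OF linear_maps_id]] assms by blast

lemma twisted_pure:
  assumes "a \<in> carrier M" "s \<in> carrier S" "b \<in> carrier M" "t \<in> carrier S"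
  shows "pure a s \<star> pure b t =
    sweedler T (\<lambda>x y. sweedler T (\<lambda>u v. pure (x \<otimes>\<^bsub>M\<^esub> u) ((s \<otimes>\<^bsub>S\<^esub> t) \<otimes>\<^bsub>S\<^esub> \<rho> y v)) b) a"
proof -
  note intros = twist_intros assms
  have scale: "scalar_ext_smult R M S (s \<otimes>\<^bsub>S\<^esub> t) \<in> linear_maps R T T"
    unfolding scalar_ext_smult_def[abs_def] by (intro intros)
  have scale_pure: "scalar_ext_smult R M S (s \<otimes>\<^bsub>S\<^esub> t) (pure m k) = pure m ((s \<otimes>\<^bsub>S\<^esub> t) \<otimes>\<^bsub>S\<^esub> k)"
    if "m \<in> carrier M" "k \<in> carrier S" for m k
    unfolding scalar_ext_smult_def using that
    by (intro tensor_lift_pure[OF module_M module_S] intros)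
  have "pure a s \<star> pure b t =
      tensor_lift T (\<lambda>b t. scalar_ext_smult R M S (s \<otimes>\<^bsub>S\<^esub> t) (twisted_prod R M comult S r a b)) (pure b t)"
    unfolding twisted_mult_def scalar_ext_smult_def twisted_prod_def
    by (intro tensor_lift_pure[OF module_M module_S] intros)
  also have "\<dots> = scalar_ext_smult R M S (s \<otimes>\<^bsub>S\<^esub> t) (twisted_prod R M comult S r a b)"
    unfolding scalar_ext_smult_def twisted_prod_def
    by (intro tensor_lift_pure[OF module_M module_S] intros)
  also have "\<dots> = sweedler T (\<lambda>x y. scalar_ext_smult R M S (s \<otimes>\<^bsub>S\<^esub> t)
      (sweedler T (\<lambda>u v. pure (x \<otimes>\<^bsub>M\<^esub> u) (\<rho> y v)) b)) a"
    unfolding twisted_prod_def by (intro linear_map_sweedler scale intros)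
  also have "\<dots> = sweedler T (\<lambda>x y. sweedler T (\<lambda>u v.
      scalar_ext_smult R M S (s \<otimes>\<^bsub>S\<^esub> t) (pure (x \<otimes>\<^bsub>M\<^esub> u) (\<rho> y v))) b) a"
    by (intro sweedler_cong linear_map_sweedler scale linear_maps_closed[OF scale] intros)
  also have "\<dots> = sweedler T (\<lambda>x y. sweedler T (\<lambda>u v. pure (x \<otimes>\<^bsub>M\<^esub> u) ((s \<otimes>\<^bsub>S\<^esub> t) \<otimes>\<^bsub>S\<^esub> \<rho> y v)) b) a"
    by (intro sweedler_cong scale_pure intros)
  finally show ?thesis .
qed

text \<open>This moves the sum over \<open>a\<close> in front of the sum over the second factor. In \<open>a \<circ> (b \<circ> c)\<close> the
  product of the first legs of \<open>b\<close> and \<open>c\<close> is then split inside the sum over \<open>a\<close>, where \<open>sweedler_pair_coassoc\<close> applies.\<close>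

lemma twisted_pure_left:
  assumes a: "a \<in> carrier M" and s: "s \<in> carrier S" and W: "W \<in> carrier T"
  shows "pure a s \<star> W = sweedler T (\<lambda>x y. tensor_lift T (\<lambda>b t.
    sweedler T (\<lambda>u v. pure (x \<otimes>\<^bsub>M\<^esub> u) ((s \<otimes>\<^bsub>S\<^esub> t) \<otimes>\<^bsub>S\<^esub> \<rho> y v)) b) W) a"
proof (rule linear_maps_tensor_eqI[OF module_M module_S _ _ _ _ W])
  note intros = twist_intros a s
  show "abelian_group T" by (rule tensor_abelian_group[OF module_M module_S])
  show "(\<lambda>W. pure a s \<star> W) \<in> linear_maps R T T"
    by (intro twisted_linear_right intros)
  show "(\<lambda>W. sweedler T (\<lambda>x y. tensor_lift T (\<lambda>b t.
      sweedler T (\<lambda>u v. pure (x \<otimes>\<^bsub>M\<^esub> u) ((s \<otimes>\<^bsub>S\<^esub> t) \<otimes>\<^bsub>S\<^esub> \<rho> y v)) b) W) a) \<in> linear_maps R T T"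
    by (intro intros)
  fix b t assume "b \<in> carrier M" "t \<in> carrier S"
  note intros = intros this
  have "pure a s \<star> pure b t =
      sweedler T (\<lambda>x y. sweedler T (\<lambda>u v. pure (x \<otimes>\<^bsub>M\<^esub> u) ((s \<otimes>\<^bsub>S\<^esub> t) \<otimes>\<^bsub>S\<^esub> \<rho> y v)) b) a"
    by (intro twisted_pure intros)
  also have "\<dots> = sweedler T (\<lambda>x y. tensor_lift T (\<lambda>b t.
      sweedler T (\<lambda>u v. pure (x \<otimes>\<^bsub>M\<^esub> u) ((s \<otimes>\<^bsub>S\<^esub> t) \<otimes>\<^bsub>S\<^esub> \<rho> y v)) b) (pure b t)) a"
    by (intro sweedler_cong tensor_lift_pure[OF module_M module_S, symmetric] intros)
  finally show "pure a s \<star> pure b t = \<dots>" .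
qed

text \<open>The bicharacter axiom under a tensor: multiplicativity of \<open>\<rho>\<close> in the first argument costs a
  coproduct of the second.\<close>

lemma pure_r_mult_left:
  assumes "m \<in> carrier M" "k \<in> carrier S" "x \<in> carrier M" "u \<in> carrier M" "z \<in> carrier M"
  shows "pure m (k \<otimes>\<^bsub>S\<^esub> \<rho> (x \<otimes>\<^bsub>M\<^esub> u) z) =
    sweedler T (\<lambda>g h. pure m (k \<otimes>\<^bsub>S\<^esub> (\<rho> x g \<otimes>\<^bsub>S\<^esub> \<rho> u h))) z"
  unfolding mult_left[OF assms(3-5)]
  using assms by (intro linear_map_sweedler[where g = "\<lambda>l. pure m (k \<otimes>\<^bsub>S\<^esub> l)"] twist_intros)

lemma pure_r_mult_right:
  assumes "m \<in> carrier M" "k \<in> carrier S" "y \<in> carrier M" "u \<in> carrier M" "z \<in> carrier M"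
  shows "pure m (k \<otimes>\<^bsub>S\<^esub> \<rho> y (u \<otimes>\<^bsub>M\<^esub> z)) =
    sweedler T (\<lambda>g h. pure m (k \<otimes>\<^bsub>S\<^esub> (\<rho> g u \<otimes>\<^bsub>S\<^esub> \<rho> h z))) y"
  unfolding mult_right[OF assms(3-5)]
  using assms by (intro linear_map_sweedler[where g = "\<lambda>l. pure m (k \<otimes>\<^bsub>S\<^esub> l)"] twist_intros)

context
  fixes a b c s t w
  assumes abc: "a \<in> carrier M" "b \<in> carrier M" "c \<in> carrier M"
    and stw: "s \<in> carrier S" "t \<in> carrier S" "w \<in> carrier S"
begin

lemma twisted_pure_assoc_left:
  "(pure a s \<star> pure b t) \<star> pure c w =
    sweedler3 T (\<lambda>x1 x2 x3. sweedler3 T (\<lambda>u1 u2 u3. sweedler3 T (\<lambda>z1 z2 z3.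
      pure ((x1 \<otimes>\<^bsub>M\<^esub> u1) \<otimes>\<^bsub>M\<^esub> z1)
        ((((s \<otimes>\<^bsub>S\<^esub> t) \<otimes>\<^bsub>S\<^esub> \<rho> x3 u3) \<otimes>\<^bsub>S\<^esub> w) \<otimes>\<^bsub>S\<^esub> (\<rho> x2 z2 \<otimes>\<^bsub>S\<^esub> \<rho> u2 z3))) c) b) a"
proof -
  note intros = twist_intros abc stw
  have pc: "pure c w \<in> carrier T" by (intro intros)
  note lin = twisted_linear_left[OF linear_maps_id pc]
  have "(pure a s \<star> pure b t) \<star> pure c w =
    sweedler T (\<lambda>x y. sweedler T (\<lambda>u v. pure (x \<otimes>\<^bsub>M\<^esub> u) ((s \<otimes>\<^bsub>S\<^esub> t) \<otimes>\<^bsub>S\<^esub> \<rho> y v)) b) a \<star> pure c w"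
    by (simp add: twisted_pure abc stw)
  also have "\<dots> = sweedler T (\<lambda>x y.
      sweedler T (\<lambda>u v. pure (x \<otimes>\<^bsub>M\<^esub> u) ((s \<otimes>\<^bsub>S\<^esub> t) \<otimes>\<^bsub>S\<^esub> \<rho> y v)) b \<star> pure c w) a"
    by (intro linear_map_sweedler lin intros)
  also have "\<dots> = sweedler T (\<lambda>x y. sweedler T (\<lambda>u v.
      pure (x \<otimes>\<^bsub>M\<^esub> u) ((s \<otimes>\<^bsub>S\<^esub> t) \<otimes>\<^bsub>S\<^esub> \<rho> y v) \<star> pure c w) b) a"
    by (intro sweedler_cong linear_map_sweedler lin twisted_closed intros)
  also have "\<dots> = sweedler T (\<lambda>x y. sweedler T (\<lambda>u v.
      sweedler T (\<lambda>p q. sweedler T (\<lambda>z z'.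
        pure (p \<otimes>\<^bsub>M\<^esub> z) ((((s \<otimes>\<^bsub>S\<^esub> t) \<otimes>\<^bsub>S\<^esub> \<rho> y v) \<otimes>\<^bsub>S\<^esub> w) \<otimes>\<^bsub>S\<^esub> \<rho> q z')) c) (x \<otimes>\<^bsub>M\<^esub> u)) b) a"
    by (intro sweedler_cong twisted_pure intros)
  also have "\<dots> = sweedler T (\<lambda>x y. sweedler T (\<lambda>u v.
      sweedler T (\<lambda>x1 x2. sweedler T (\<lambda>u1 u2. sweedler T (\<lambda>z z'.
        pure ((x1 \<otimes>\<^bsub>M\<^esub> u1) \<otimes>\<^bsub>M\<^esub> z)
          ((((s \<otimes>\<^bsub>S\<^esub> t) \<otimes>\<^bsub>S\<^esub> \<rho> y v) \<otimes>\<^bsub>S\<^esub> w) \<otimes>\<^bsub>S\<^esub> \<rho> (x2 \<otimes>\<^bsub>M\<^esub> u2) z')) c) u) x) b) a"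
    by (intro sweedler_cong sweedler_mult intros)
  also have "\<dots> = sweedler T (\<lambda>x y. sweedler T (\<lambda>u v.
      sweedler T (\<lambda>x1 x2. sweedler T (\<lambda>u1 u2. sweedler3 T (\<lambda>z1 z2 z3.
        pure ((x1 \<otimes>\<^bsub>M\<^esub> u1) \<otimes>\<^bsub>M\<^esub> z1)
          ((((s \<otimes>\<^bsub>S\<^esub> t) \<otimes>\<^bsub>S\<^esub> \<rho> y v) \<otimes>\<^bsub>S\<^esub> w) \<otimes>\<^bsub>S\<^esub> (\<rho> x2 z2 \<otimes>\<^bsub>S\<^esub> \<rho> u2 z3))) c) u) x) b) a"
    by (intro sweedler_cong pure_r_mult_left intros)
  also have "\<dots> = sweedler3 T (\<lambda>x1 x2 x3. sweedler3 T (\<lambda>u1 u2 u3. sweedler3 T (\<lambda>z1 z2 z3.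
      pure ((x1 \<otimes>\<^bsub>M\<^esub> u1) \<otimes>\<^bsub>M\<^esub> z1)
        ((((s \<otimes>\<^bsub>S\<^esub> t) \<otimes>\<^bsub>S\<^esub> \<rho> x3 u3) \<otimes>\<^bsub>S\<^esub> w) \<otimes>\<^bsub>S\<^esub> (\<rho> x2 z2 \<otimes>\<^bsub>S\<^esub> \<rho> u2 z3))) c) b) a"
    by (intro sweedler_pair_coassoc intros)
  finally show ?thesis .
qed

lemma twisted_pure_assoc_right:
  "pure a s \<star> (pure b t \<star> pure c w) =
    sweedler3 T (\<lambda>x1 x2 x3. sweedler3 T (\<lambda>u1 u2 u3. sweedler3 T (\<lambda>z1 z2 z3.
      pure (x1 \<otimes>\<^bsub>M\<^esub> (u1 \<otimes>\<^bsub>M\<^esub> z1))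
        ((s \<otimes>\<^bsub>S\<^esub> ((t \<otimes>\<^bsub>S\<^esub> w) \<otimes>\<^bsub>S\<^esub> \<rho> u3 z3)) \<otimes>\<^bsub>S\<^esub> (\<rho> x2 u2 \<otimes>\<^bsub>S\<^esub> \<rho> x3 z2))) c) b) a"
proof -
  note intros = twist_intros abc stw
  \<comment> \<open>left multiplication by \<open>pure a s\<close> with the legs \<open>x\<close>, \<open>y\<close> of \<open>a\<close> held fixed\<close>
  define \<Lambda> where "\<Lambda> x y = tensor_lift T (\<lambda>b t.
    sweedler T (\<lambda>u v. pure (x \<otimes>\<^bsub>M\<^esub> u) ((s \<otimes>\<^bsub>S\<^esub> t) \<otimes>\<^bsub>S\<^esub> \<rho> y v)) b)" for x y
  have lin: "\<Lambda> x y \<in> linear_maps R T T" if "x \<in> carrier M" "y \<in> carrier M" for x y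
    unfolding \<Lambda>_def using that by (intro intros tensor_lift_linear[OF module_M module_S])
  have \<Lambda>_pure: "\<Lambda> x y (pure m k) =
      sweedler T (\<lambda>u v. pure (x \<otimes>\<^bsub>M\<^esub> u) ((s \<otimes>\<^bsub>S\<^esub> k) \<otimes>\<^bsub>S\<^esub> \<rho> y v)) m"
    if "x \<in> carrier M" "y \<in> carrier M" "m \<in> carrier M" "k \<in> carrier S" for x y m k
    unfolding \<Lambda>_def using that by (intro intros tensor_lift_pure[OF module_M module_S])
  note \<Lambda>_closed = linear_maps_closed[OF lin]
  have "pure a s \<star> (pure b t \<star> pure c w) = sweedler T (\<lambda>x y. \<Lambda> x y (pure b t \<star> pure c w)) a"
    unfolding \<Lambda>_def by (intro twisted_pure_left twisted_closed intros)
  also have "\<dots> = sweedler T (\<lambda>x y. \<Lambda> x y (sweedler T (\<lambda>u v. sweedler T (\<lambda>z q.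
      pure (u \<otimes>\<^bsub>M\<^esub> z) ((t \<otimes>\<^bsub>S\<^esub> w) \<otimes>\<^bsub>S\<^esub> \<rho> v q)) c) b)) a"
    by (simp add: twisted_pure abc stw)
  also have "\<dots> = sweedler T (\<lambda>x y. sweedler T (\<lambda>u v. \<Lambda> x y (sweedler T (\<lambda>z q.
      pure (u \<otimes>\<^bsub>M\<^esub> z) ((t \<otimes>\<^bsub>S\<^esub> w) \<otimes>\<^bsub>S\<^esub> \<rho> v q)) c)) b) a"
    by (intro sweedler_cong linear_map_sweedler lin \<Lambda>_closed intros)
  also have "\<dots> = sweedler T (\<lambda>x y. sweedler T (\<lambda>u v. sweedler T (\<lambda>z q. \<Lambda> x y (
      pure (u \<otimes>\<^bsub>M\<^esub> z) ((t \<otimes>\<^bsub>S\<^esub> w) \<otimes>\<^bsub>S\<^esub> \<rho> v q))) c) b) a"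
    by (intro sweedler_cong linear_map_sweedler lin \<Lambda>_closed intros)
  also have "\<dots> = sweedler T (\<lambda>x y. sweedler T (\<lambda>u v. sweedler T (\<lambda>z q.
      sweedler T (\<lambda>p p'. pure (x \<otimes>\<^bsub>M\<^esub> p)
        ((s \<otimes>\<^bsub>S\<^esub> ((t \<otimes>\<^bsub>S\<^esub> w) \<otimes>\<^bsub>S\<^esub> \<rho> v q)) \<otimes>\<^bsub>S\<^esub> \<rho> y p')) (u \<otimes>\<^bsub>M\<^esub> z)) c) b) a"
    by (intro sweedler_cong \<Lambda>_pure intros)
  also have "\<dots> = sweedler T (\<lambda>x y. sweedler T (\<lambda>u v. sweedler T (\<lambda>z q.
      sweedler T (\<lambda>u1 u2. sweedler T (\<lambda>z1 z2. pure (x \<otimes>\<^bsub>M\<^esub> (u1 \<otimes>\<^bsub>M\<^esub> z1))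
        ((s \<otimes>\<^bsub>S\<^esub> ((t \<otimes>\<^bsub>S\<^esub> w) \<otimes>\<^bsub>S\<^esub> \<rho> v q)) \<otimes>\<^bsub>S\<^esub> \<rho> y (u2 \<otimes>\<^bsub>M\<^esub> z2))) z) u) c) b) a"
    by (intro sweedler_cong sweedler_mult intros)
  also have "\<dots> = sweedler T (\<lambda>x y. sweedler3 T (\<lambda>u1 u2 u3. sweedler3 T (\<lambda>z1 z2 z3.
      pure (x \<otimes>\<^bsub>M\<^esub> (u1 \<otimes>\<^bsub>M\<^esub> z1))
        ((s \<otimes>\<^bsub>S\<^esub> ((t \<otimes>\<^bsub>S\<^esub> w) \<otimes>\<^bsub>S\<^esub> \<rho> u3 z3)) \<otimes>\<^bsub>S\<^esub> \<rho> y (u2 \<otimes>\<^bsub>M\<^esub> z2))) c) b) a"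
    by (intro sweedler_cong sweedler_pair_coassoc intros)
  also have "\<dots> = sweedler T (\<lambda>x y. sweedler3 T (\<lambda>u1 u2 u3. sweedler3 T (\<lambda>z1 z2 z3.
      sweedler T (\<lambda>y1 y2. pure (x \<otimes>\<^bsub>M\<^esub> (u1 \<otimes>\<^bsub>M\<^esub> z1))
        ((s \<otimes>\<^bsub>S\<^esub> ((t \<otimes>\<^bsub>S\<^esub> w) \<otimes>\<^bsub>S\<^esub> \<rho> u3 z3)) \<otimes>\<^bsub>S\<^esub> (\<rho> y1 u2 \<otimes>\<^bsub>S\<^esub> \<rho> y2 z2))) y) c) b) a"
    by (intro sweedler_cong pure_r_mult_right intros)
  also have "\<dots> = sweedler T (\<lambda>x y. sweedler3 T (\<lambda>u1 u2 u3. sweedler T (\<lambda>y1 y2.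
      sweedler3 T (\<lambda>z1 z2 z3. pure (x \<otimes>\<^bsub>M\<^esub> (u1 \<otimes>\<^bsub>M\<^esub> z1))
        ((s \<otimes>\<^bsub>S\<^esub> ((t \<otimes>\<^bsub>S\<^esub> w) \<otimes>\<^bsub>S\<^esub> \<rho> u3 z3)) \<otimes>\<^bsub>S\<^esub> (\<rho> y1 u2 \<otimes>\<^bsub>S\<^esub> \<rho> y2 z2))) c) y) b) a"
    by (intro sweedler_cong sweedler_sweedler3_swap intros)
  also have "\<dots> = sweedler3 T (\<lambda>x1 x2 x3. sweedler3 T (\<lambda>u1 u2 u3. sweedler3 T (\<lambda>z1 z2 z3.
      pure (x1 \<otimes>\<^bsub>M\<^esub> (u1 \<otimes>\<^bsub>M\<^esub> z1))
        ((s \<otimes>\<^bsub>S\<^esub> ((t \<otimes>\<^bsub>S\<^esub> w) \<otimes>\<^bsub>S\<^esub> \<rho> u3 z3)) \<otimes>\<^bsub>S\<^esub> (\<rho> x2 u2 \<otimes>\<^bsub>S\<^esub> \<rho> x3 z2))) c) b) a"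
    by (intro sweedler_cong sweedler_sweedler3_swap intros)
  finally show ?thesis .
qed

text \<open>In the normal forms of the two bracketings, the form \<open>\<rho>\<close> pairs the second and third legs of
  \<open>a\<close>, \<open>b\<close>, \<open>c\<close> differently. Cocommutativity exchanges these legs of \<open>b\<close>, then those of \<open>a\<close>; those
  of \<open>c\<close> already match.\<close>

lemma twisted_pure_assoc:
  "(pure a s \<star> pure b t) \<star> pure c w = pure a s \<star> (pure b t \<star> pure c w)"
proof -
  note intros = twist_intros abc stw
  \<comment> \<open>the summand of the right bracketing\<close>
  define G where "G x1 x2 x3 u1 u2 u3 z1 z2 z3 =
    pure (x1 \<otimes>\<^bsub>M\<^esub> (u1 \<otimes>\<^bsub>M\<^esub> z1))
        ((s \<otimes>\<^bsub>S\<^esub> ((t \<otimes>\<^bsub>S\<^esub> w) \<otimes>\<^bsub>S\<^esub> \<rho> u3 z3)) \<otimes>\<^bsub>S\<^esub> (\<rho> x2 u2 \<otimes>\<^bsub>S\<^esub> \<rho> x3 z2))"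
    for x1 x2 x3 u1 u2 u3 z1 z2 z3
  have G: "pure ((x1 \<otimes>\<^bsub>M\<^esub> u1) \<otimes>\<^bsub>M\<^esub> z1)
        ((((s \<otimes>\<^bsub>S\<^esub> t) \<otimes>\<^bsub>S\<^esub> \<rho> x3 u3) \<otimes>\<^bsub>S\<^esub> w) \<otimes>\<^bsub>S\<^esub> (\<rho> x2 z2 \<otimes>\<^bsub>S\<^esub> \<rho> u2 z3)) =
      G x1 x3 x2 u1 u3 u2 z1 z2 z3"
    if "x1 \<in> carrier M" "x2 \<in> carrier M" "x3 \<in> carrier M" "u1 \<in> carrier M" "u2 \<in> carrier M"
      "u3 \<in> carrier M" "z1 \<in> carrier M" "z2 \<in> carrier M" "z3 \<in> carrier M"
    for x1 x2 x3 u1 u2 u3 z1 z2 z3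
    using that stw unfolding G_def
    by (simp add: m_assoc S.m_ac r_closed pure_tensor_closed[OF module_M module_M])
  have G_closed: "G x1 x2 x3 u1 u2 u3 z1 z2 z3 \<in> carrier T"
    if "x1 \<in> carrier M" "x2 \<in> carrier M" "x3 \<in> carrier M" "u1 \<in> carrier M" "u2 \<in> carrier M"
      "u3 \<in> carrier M" "z1 \<in> carrier M" "z2 \<in> carrier M" "z3 \<in> carrier M"
    for x1 x2 x3 u1 u2 u3 z1 z2 z3
    using that unfolding G_def by (intro intros)
  have "(pure a s \<star> pure b t) \<star> pure c w =
    sweedler3 T (\<lambda>x1 x2 x3. sweedler3 T (\<lambda>u1 u2 u3. sweedler3 T (\<lambda>z1 z2 z3.
      G x1 x3 x2 u1 u3 u2 z1 z2 z3) c) b) a"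
    unfolding twisted_pure_assoc_left by (intro sweedler_cong G G_closed intros)
  also have "\<dots> = sweedler3 T (\<lambda>x1 x2 x3. sweedler3 T (\<lambda>u1 u2 u3. sweedler3 T (\<lambda>z1 z2 z3.
      G x1 x3 x2 u1 u2 u3 z1 z2 z3) c) b) a"
    unfolding G_def by (intro sweedler_cong sweedler_cocommute intros)
  also have "\<dots> = sweedler3 T (\<lambda>x1 x2 x3. sweedler3 T (\<lambda>u1 u2 u3. sweedler3 T (\<lambda>z1 z2 z3.
      G x1 x2 x3 u1 u2 u3 z1 z2 z3) c) b) a"
    unfolding G_def by (intro sweedler_cong sweedler_cocommute intros)
  also have "\<dots> = pure a s \<star> (pure b t \<star> pure c w)"
    unfolding G_def twisted_pure_assoc_right ..
  finally show ?thesis .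
qed

end

text \<open>Both sides are linear in each factor, so the factors are replaced by pure tensors one at a time.\<close>

lemma twisted_assoc:
  assumes X: "X \<in> carrier T" and Y: "Y \<in> carrier T" and Z: "Z \<in> carrier T"
  shows "(X \<star> Y) \<star> Z = X \<star> (Y \<star> Z)"
proof -
  note intros = twist_intros twisted_linear_left twisted_linear_right twisted_closed
  note ext = linear_maps_tensor_eqI[OF module_M module_S tensor_abelian_group[OF module_M module_S]]
  have 1: "(pure a s \<star> pure b t) \<star> Z = pure a s \<star> (pure b t \<star> Z)"
    if "a \<in> carrier M" "s \<in> carrier S" "b \<in> carrier M" "t \<in> carrier S" for a s b t
    using that by (rule_tac ext[OF _ _ _ Z]) (intro intros twisted_pure_assoc; assumption)+
  have 2: "(pure a s \<star> Y) \<star> Z = pure a s \<star> (Y \<star> Z)"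
    if "a \<in> carrier M" "s \<in> carrier S" for a s
    using that Z by (rule_tac ext[OF _ _ _ Y]) (intro intros 1; assumption)+
  show ?thesis
    using Y Z by (rule_tac ext[OF _ _ _ X]) (intro intros 2; assumption)+
qed

section \<open>Unit laws and commutativity\<close>

lemma counit_scalar:
  assumes "m \<in> carrier M" "t \<in> carrier S" "v \<in> carrier M"
  shows "pure m (t \<otimes>\<^bsub>S\<^esub> (counit v \<odot>\<^bsub>S\<^esub> \<one>\<^bsub>S\<^esub>)) = pure (counit v \<odot>\<^bsub>M\<^esub> m) t"
proof -
  have v: "counit v \<in> carrier R"
    using ring_hom_closed[OF counit_hom assms(3)] .
  then have "t \<otimes>\<^bsub>S\<^esub> (counit v \<odot>\<^bsub>S\<^esub> \<one>\<^bsub>S\<^esub>) = counit v \<odot>\<^bsub>S\<^esub> t"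
    using assms by (simp add: assoc_algebra.smult_mult_right[OF S_assoc_algebra])
  then show ?thesis
    using assms v by (simp add: pure_tensor_balanced[OF module_M module_S])
qed

text \<open>The counit axiom with coefficients in \<open>S\<close>. The same axiom serves both unit laws, because the legs
  met by the counit are always the second legs.\<close>

lemma counit_scalar_sweedler:
  assumes "a \<in> carrier M" "t \<in> carrier S"
  shows "sweedler T (\<lambda>x y. pure (counit y \<odot>\<^bsub>M\<^esub> x) t) a = pure a t"
proof -
  have closed: "counit y \<odot>\<^bsub>M\<^esub> x \<in> carrier M" if "x \<in> carrier M" "y \<in> carrier M" for x y
    using that ring_hom_closed[OF counit_hom] by (simp add: module.smult_closed[OF module_M])
  have "sweedler T (\<lambda>x y. pure (counit y \<odot>\<^bsub>M\<^esub> x) t) a =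
      pure (sweedler M (\<lambda>x y. counit y \<odot>\<^bsub>M\<^esub> x) a) t"
    using assms by (intro linear_map_sweedler[where g = "\<lambda>m. pure m t", symmetric] closed twist_intros)
  then show ?thesis
    using assms by (simp add: counit_right)
qed

lemma twisted_one_left:
  assumes X: "X \<in> carrier T"
  shows "pure \<one>\<^bsub>M\<^esub> \<one>\<^bsub>S\<^esub> \<star> X = X"
proof (rule linear_maps_tensor_eqI[OF module_M module_S _ _ linear_maps_id _ X])
  show "abelian_group T" by (rule tensor_abelian_group[OF module_M module_S])
  show "(\<lambda>X. pure \<one>\<^bsub>M\<^esub> \<one>\<^bsub>S\<^esub> \<star> X) \<in> linear_maps R T T"
    by (intro twisted_linear_right twist_intros)
  fix b t assume bt: "b \<in> carrier M" "t \<in> carrier S"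
  note intros = twist_intros bt
  have "pure \<one>\<^bsub>M\<^esub> \<one>\<^bsub>S\<^esub> \<star> pure b t = sweedler T (\<lambda>x y. sweedler T (\<lambda>u v.
      pure (x \<otimes>\<^bsub>M\<^esub> u) ((\<one>\<^bsub>S\<^esub> \<otimes>\<^bsub>S\<^esub> t) \<otimes>\<^bsub>S\<^esub> \<rho> y v)) b) \<one>\<^bsub>M\<^esub>"
    by (intro twisted_pure intros)
  also have "\<dots> = sweedler T (\<lambda>u v. pure (\<one>\<^bsub>M\<^esub> \<otimes>\<^bsub>M\<^esub> u) ((\<one>\<^bsub>S\<^esub> \<otimes>\<^bsub>S\<^esub> t) \<otimes>\<^bsub>S\<^esub> \<rho> \<one>\<^bsub>M\<^esub> v)) b"
    by (intro sweedler_one intros)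
  also have "\<dots> = sweedler T (\<lambda>u v. pure (counit v \<odot>\<^bsub>M\<^esub> u) t) b"
    using bt ring_hom_closed[OF counit_hom]
    by (intro sweedler_cong) (simp_all add: one_left counit_scalar intros module.smult_closed[OF module_M])
  also have "\<dots> = pure b t"
    using bt by (rule counit_scalar_sweedler)
  finally show "pure \<one>\<^bsub>M\<^esub> \<one>\<^bsub>S\<^esub> \<star> pure b t = pure b t" .
qed

lemma twisted_one_right:
  assumes X: "X \<in> carrier T"
  shows "X \<star> pure \<one>\<^bsub>M\<^esub> \<one>\<^bsub>S\<^esub> = X"
proof (rule linear_maps_tensor_eqI[OF module_M module_S _ _ linear_maps_id _ X])
  show "abelian_group T" by (rule tensor_abelian_group[OF module_M module_S])
  show "(\<lambda>X. X \<star> pure \<one>\<^bsub>M\<^esub> \<one>\<^bsub>S\<^esub>) \<in> linear_maps R T T"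
    by (intro twisted_linear_left twist_intros)
  fix a s assume as: "a \<in> carrier M" "s \<in> carrier S"
  note intros = twist_intros as
  have "pure a s \<star> pure \<one>\<^bsub>M\<^esub> \<one>\<^bsub>S\<^esub> = sweedler T (\<lambda>x y. sweedler T (\<lambda>u v.
      pure (x \<otimes>\<^bsub>M\<^esub> u) ((s \<otimes>\<^bsub>S\<^esub> \<one>\<^bsub>S\<^esub>) \<otimes>\<^bsub>S\<^esub> \<rho> y v)) \<one>\<^bsub>M\<^esub>) a"
    by (intro twisted_pure intros)
  also have "\<dots> = sweedler T (\<lambda>x y. pure (x \<otimes>\<^bsub>M\<^esub> \<one>\<^bsub>M\<^esub>) ((s \<otimes>\<^bsub>S\<^esub> \<one>\<^bsub>S\<^esub>) \<otimes>\<^bsub>S\<^esub> \<rho> y \<one>\<^bsub>M\<^esub>)) a"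
    by (intro sweedler_cong sweedler_one intros)
  also have "\<dots> = sweedler T (\<lambda>x y. pure (counit y \<odot>\<^bsub>M\<^esub> x) s) a"
    using as ring_hom_closed[OF counit_hom]
    by (intro sweedler_cong) (simp_all add: one_right counit_scalar intros module.smult_closed[OF module_M])
  also have "\<dots> = pure a s"
    using as by (rule counit_scalar_sweedler)
  finally show "pure a s \<star> pure \<one>\<^bsub>M\<^esub> \<one>\<^bsub>S\<^esub> = pure a s" .
qed

lemma twisted_commute:
  assumes M_comm: "\<And>x y. \<lbrakk>x \<in> carrier M; y \<in> carrier M\<rbrakk> \<Longrightarrow> x \<otimes>\<^bsub>M\<^esub> y = y \<otimes>\<^bsub>M\<^esub> x"
    and sym: "\<And>x y. \<lbrakk>x \<in> carrier M; y \<in> carrier M\<rbrakk> \<Longrightarrow> \<rho> x y = \<rho> y x"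
    and X: "X \<in> carrier T" and Y: "Y \<in> carrier T"
  shows "X \<star> Y = Y \<star> X"
proof -
  note intros = twist_intros twisted_linear_left twisted_linear_right
  note ext = linear_maps_tensor_eqI[OF module_M module_S tensor_abelian_group[OF module_M module_S]]
  have pure: "pure a s \<star> pure b t = pure b t \<star> pure a s"
    if abst: "a \<in> carrier M" "s \<in> carrier S" "b \<in> carrier M" "t \<in> carrier S" for a s b t
  proof -
    have "pure a s \<star> pure b t =
        sweedler T (\<lambda>x y. sweedler T (\<lambda>u v. pure (x \<otimes>\<^bsub>M\<^esub> u) ((s \<otimes>\<^bsub>S\<^esub> t) \<otimes>\<^bsub>S\<^esub> \<rho> y v)) b) a"
      using abst by (rule twisted_pure)
    also have "\<dots> = sweedler T (\<lambda>x y. sweedler T (\<lambda>u v. pure (u \<otimes>\<^bsub>M\<^esub> x) ((t \<otimes>\<^bsub>S\<^esub> s) \<otimes>\<^bsub>S\<^esub> \<rho> v y)) b) a"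
    proof (intro sweedler_cong intros abst)
      fix x y u v assume xyuv: "x \<in> carrier M" "y \<in> carrier M" "u \<in> carrier M" "v \<in> carrier M"
      show "pure (x \<otimes>\<^bsub>M\<^esub> u) ((s \<otimes>\<^bsub>S\<^esub> t) \<otimes>\<^bsub>S\<^esub> \<rho> y v) = pure (u \<otimes>\<^bsub>M\<^esub> x) ((t \<otimes>\<^bsub>S\<^esub> s) \<otimes>\<^bsub>S\<^esub> \<rho> v y)"
        using abst M_comm[OF xyuv(1,3)] sym[OF xyuv(2,4)] by (simp add: S.m_comm)
    qed
    also have "\<dots> = sweedler T (\<lambda>u v. sweedler T (\<lambda>x y. pure (u \<otimes>\<^bsub>M\<^esub> x) ((t \<otimes>\<^bsub>S\<^esub> s) \<otimes>\<^bsub>S\<^esub> \<rho> v y)) a) b"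
      by (intro sweedler_swap intros abst)
    also have "\<dots> = pure b t \<star> pure a s"
      using abst by (intro twisted_pure[symmetric])
    finally show ?thesis .
  qed
  have "pure a s \<star> Y = Y \<star> pure a s" if "a \<in> carrier M" "s \<in> carrier S" for a s
    using that by (rule_tac ext[OF _ _ _ Y]) (intro intros pure; assumption)+
  then show ?thesis
    using Y by (rule_tac ext[OF _ _ _ X]) (intro intros; assumption)+
qed

section \<open>The twisted algebra\<close>

lemma twisted_assoc_algebra: "assoc_algebra R (twisted_algebra R M comult S r)"
proof -
  let ?A = "twisted_algebra R M comult S r"
  interpret T: module R T by (rule module_T)
  have A: "carrier ?A = carrier T" "add ?A = add T" "\<zero>\<^bsub>?A\<^esub> = \<zero>\<^bsub>T\<^esub>" "smult ?A = smult T"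
    "\<one>\<^bsub>?A\<^esub> = pure \<one>\<^bsub>M\<^esub> \<one>\<^bsub>S\<^esub>" "X \<otimes>\<^bsub>?A\<^esub> Y = X \<star> Y" for X Y
    by (simp_all add: twisted_algebra_def)
  note left = twisted_linear_left[OF linear_maps_id] and right = twisted_linear_right[OF linear_maps_id]
  have one: "pure \<one>\<^bsub>M\<^esub> \<one>\<^bsub>S\<^esub> \<in> carrier T"
    by (intro twist_intros)
  have ag: "abelian_group ?A"
  proof (rule abelian_groupI; unfold A)
    show "\<exists>Y\<in>carrier T. Y \<oplus>\<^bsub>T\<^esub> X = \<zero>\<^bsub>T\<^esub>" if "X \<in> carrier T" for X
      using that T.l_neg T.a_inv_closed by blast
  qed (simp_all add: T.a_ac)
  show ?thesis
  proof (intro assoc_algebra.intro assoc_algebra_axioms.intro moduleI ringI ag module.axioms(1)[OF module_T])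
    show "monoid ?A"
      by (rule monoidI) (simp_all add: A twisted_closed one twisted_assoc twisted_one_left twisted_one_right)
  qed (simp_all add: A T.smult_l_distr T.smult_r_distr T.smult_assoc1
      linear_maps_add[OF left] linear_maps_add[OF right] linear_maps_smult[OF left] linear_maps_smult[OF right])
qed

lemma twisted_cring:
  assumes "symmetric_bicharacter R M r" and "cring M"
  shows "cring (twisted_algebra R M comult S r)"
proof -
  interpret A: assoc_algebra R "twisted_algebra R M comult S r"
    by (rule twisted_assoc_algebra)
  interpret M': cring M by fact
  show ?thesis
  proof (intro cring.intro A.ring_axioms A.monoid_comm_monoidI)
    fix X Y
    assume "X \<in> carrier (twisted_algebra R M comult S r)" "Y \<in> carrier (twisted_algebra R M comult S r)"
    then show "X \<otimes>\<^bsub>twisted_algebra R M comult S r\<^esub> Y = Y \<otimes>\<^bsub>twisted_algebra R M comult S r\<^esub> X"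
      using twisted_commute[OF M'.m_comm] assms(1)
      by (simp add: twisted_algebra_def symmetric_bicharacter_def)
  qed
qed

end

theorem lemma2p31:
  fixes R :: "('r, 'x) ring_scheme"
    and M :: "('r, 'm, 'y) module_scheme"
    and S :: "('r, 's, 'z) module_scheme"
    and comult :: "'m \<Rightarrow> ('m, 'm) tensor"
    and counit :: "'m \<Rightarrow> 'r"
    and r :: "('m, 'm) tensor \<Rightarrow> 's"
  assumes "cring R"
    and "cocommutative_bialgebra R M comult counit"
    and "algebra R S"
    and "bicharacter R M comult counit S r"
  shows "assoc_algebra R (twisted_algebra R M comult S r) \<and>
    (symmetric_bicharacter R M r \<and> cring M \<longrightarrow> cring (twisted_algebra R M comult S r))"
proof -
  interpret bicharacter_twist R M comult counit S r
    using assms(2,4) by (rule bicharacter_twist.intro)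
  show ?thesis
    using twisted_assoc_algebra twisted_cring by blast
qed

end
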